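(* Let $(V,\|\cdot\|)$ be a real Banach space whose dual $V^*$ has the Radon–Nikodým property, let $\Psi:V\to[0,+\infty)$ be a convex $C^1$ functional whose convex conjugate $\Psi^*$ is also $C^1$ on $V^*$, and let $\Phi:V\to(-\infty,+\infty]$ be proper, lower semicontinuous and $\lambda$-convex for $\Psi$ for some $\lambda\in\mathbb R$. Assume: (a) there exist $\alpha>1$ and $C_\alpha>0$ such that $\|y-x\|^\alpha\le C_\alpha D_\Psi(y,x)$ for all $x,y\in V$; and there exists a continuous function $g:(0,+\infty)\to(0,+\infty)$ with $g(0):=\lim_{r\to0}g(r)=+\infty$ and $g(\|\varphi\|+\|\psi\|)\,\|\varphi-\psi\|^2\le D_{\Psi^*}(\varphi,\psi)$ for all $\varphi,\psi\in V^*$ (with $\infty\cdot0:=0$); (b) there exist $\beta>0$, $C_\beta>0$, $m_\beta\ge0$ such that $\|\nabla\Psi(x)\|\le C_\beta\|x\|^\beta+m_\beta$ for all $x\in V$; (c) $\inf_{x\in V}\Phi(x)>-\infty$; (d) for each $r>0$ and $c\in\mathbb R$ the set $\{x\in V:\|x\|\le r,\ \Phi(x)\le c\}$ is compact. Then for every $x_0\in V$ with $\Phi(x_0)<+\infty$ there exists a $\Psi$-mirror flow for $\Phi$ starting from $x_0$.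
   Context: $\nabla\Psi:V\to V^*$ and $\nabla\Psi^*$ are the Fréchet derivatives; $\Psi^*(\varphi)=\sup_{x\in V}(\langle\varphi,x\rangle-\Psi(x))$. Bregman divergences: $D_\Psi(x,y):=\Psi(x)-\Psi(y)-\langle\nabla\Psi(y),x-y\rangle$ for $x,y\in V$, and $D_{\Psi^*}(\varphi,\psi):=\Psi^*(\varphi)-\Psi^*(\psi)-\langle\nabla\Psi^*(\psi),\varphi-\psi\rangle$ for $\varphi,\psi\in V^*$. $\Phi$ is $\lambda$-convex for $\Psi$ if $\Phi-\lambda\Psi$ is convex. Proper means $\Phi\not\equiv+\infty$. The Fréchet subdifferential at $x$ with $\Phi(x)<+\infty$ is $\partial_F\Phi(x):=\{\xi\in V^*:\liminf_{y\to x}\frac{\Phi(y)-\Phi(x)-\langle\xi,y-x\rangle}{\|y-x\|}\ge0\}$ (empty if $\Phi(x)=+\infty$). A $\Psi$-mirror flow for $\Phi$ starting from $x_0$ is a map $t\in[0,+\infty)\mapsto x_t\in V$ with value $x_0$ at $t=0$ such that $t\mapsto\nabla\Psi(x_t)\in V^*$ is locally absolutely continuous (there is $A\in L^1_{\rm loc}([0,+\infty))$ with $\|\nabla\Psi(x_t)-\nabla\Psi(x_s)\|\le\int_s^tA(r)\,dr$ for $0\le s\le t$) and $\frac{d}{dt}\nabla\Psi(x_t)\in-\partial_F\Phi(x_t)$ for Lebesgue-a.e. $t>0$. *)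

theory Defs
  imports "HOL-Analysis.Analysis"
begin

section \<open>The Radon--Nikodym property\<close>

text \<open>
  The library's \<open>has_bochner_integral\<close> asks for a second countable codomain, which a dual space need
  not be. The definition below is the same one without that sort constraint. The approximation
  by simple functions forces the integrand to be strongly measurable.
\<close>

definition has_bochner_int ::
    "'s measure \<Rightarrow> ('s \<Rightarrow> 'b::real_normed_vector) \<Rightarrow> 'b \<Rightarrow> bool" where
  "has_bochner_int M f I \<longleftrightarrow>
     f \<in> borel_measurable M \<and>
     (\<exists>s. (\<forall>i::nat. Bochner_Integration.simple_bochner_integrable M (s i)) \<and>
          (\<lambda>i. \<integral>\<^sup>+x. norm (f x - s i x) \<partial>M) \<longlonglongrightarrow> 0 \<and>
          (\<lambda>i. Bochner_Integration.simple_bochner_integral M (s i)) \<longlonglongrightarrow> I)"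

definition vector_measure :: "'s measure \<Rightarrow> ('s set \<Rightarrow> 'b::real_normed_vector) \<Rightarrow> bool" where
  "vector_measure M F \<longleftrightarrow>
     (\<forall>A :: nat \<Rightarrow> 's set. range A \<subseteq> sets M \<and> disjoint_family A \<longrightarrow>
        (\<lambda>n. F (A n)) sums F (\<Union>n. A n))"

definition finite_variation :: "'s measure \<Rightarrow> ('s set \<Rightarrow> 'b::real_normed_vector) \<Rightarrow> bool" where
  "finite_variation M F \<longleftrightarrow>
     (\<exists>C. \<forall>P. finite P \<and> P \<subseteq> sets M \<and> disjoint P \<longrightarrow> (\<Sum>A\<in>P. norm (F A)) \<le> C)"

text \<open>
  Every \<open>M\<close>-continuous vector measure of bounded variation on a finite measure space has a
  Bochner integrable density. HOL cannot quantify over the type of the points of the measure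
  space, so the measure spaces are those whose points are real numbers (with an arbitrary
  sigma-algebra and an arbitrary finite measure). Consequently the predicate is implied by the
  property for all finite measure spaces; it is equivalent to it, because Lebesgue measure on
  the unit interval is already enough. For a countably additive \<open>F\<close>, \<open>M\<close>-continuity means vanishing
  on null sets.
\<close>

definition radon_nikodym_property :: "'b::banach itself \<Rightarrow> bool" where
  "radon_nikodym_property (_ :: 'b itself) \<longleftrightarrow>
     (\<forall>(M :: real measure) (F :: real set \<Rightarrow> 'b).
        finite_measure M \<and> vector_measure M F \<and> finite_variation M F \<and>
        (\<forall>A\<in>null_sets M. F A = 0) \<longrightarrow>
        (\<exists>g. \<forall>A\<in>sets M. has_bochner_int M (\<lambda>x. indicator A x *\<^sub>R g x) (F A)))"


section \<open>Gradients, conjugates and Bregman divergences\<close>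

text \<open>Meaningful only at points where \<open>f\<close> is Frechet differentiable.\<close>

definition gradient :: "('v::real_normed_vector \<Rightarrow> real) \<Rightarrow> 'v \<Rightarrow> 'v \<Rightarrow>\<^sub>L real" where
  "gradient f x = Blinfun (frechet_derivative f (at x))"

definition C1_functional :: "('v::real_normed_vector \<Rightarrow> real) \<Rightarrow> bool" where
  "C1_functional f \<longleftrightarrow> (\<forall>x. f differentiable (at x)) \<and> continuous_on UNIV (gradient f)"

definition convex_conjugate :: "('v::real_normed_vector \<Rightarrow> real) \<Rightarrow> ('v \<Rightarrow>\<^sub>L real) \<Rightarrow> ereal" where
  "convex_conjugate f \<phi> = (SUP x. ereal (blinfun_apply \<phi> x - f x))"

definition bregman :: "('v::real_normed_vector \<Rightarrow> real) \<Rightarrow> 'v \<Rightarrow> 'v \<Rightarrow> real" where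
  "bregman f x y = f x - f y - blinfun_apply (gradient f y) (x - y)"


section \<open>Extended-valued functionals\<close>

text \<open>
  These are used only for functionals that never take the value \<open>-\<infinity>\<close>, so that no
  indeterminate expression arises.
\<close>

definition lower_semicontinuous :: "('v::topological_space \<Rightarrow> ereal) \<Rightarrow> bool" where
  "lower_semicontinuous f \<longleftrightarrow> (\<forall>x. f x \<le> Liminf (at x) f)"

definition ereal_convex :: "('v::real_vector \<Rightarrow> ereal) \<Rightarrow> bool" where
  "ereal_convex f \<longleftrightarrow>
     (\<forall>x y t. 0 < t \<and> t < 1 \<longrightarrow>
        f ((1 - t) *\<^sub>R x + t *\<^sub>R y) \<le> ereal (1 - t) * f x + ereal t * f y)"

definition lambda_convex_for ::
    "real \<Rightarrow> ('v::real_vector \<Rightarrow> real) \<Rightarrow> ('v \<Rightarrow> ereal) \<Rightarrow> bool" where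
  "lambda_convex_for lam \<Psi> \<Phi> \<longleftrightarrow> ereal_convex (\<lambda>x. \<Phi> x - ereal (lam * \<Psi> x))"

definition frechet_subdifferential ::
    "('v::real_normed_vector \<Rightarrow> ereal) \<Rightarrow> 'v \<Rightarrow> ('v \<Rightarrow>\<^sub>L real) set" where
  "frechet_subdifferential \<Phi> x =
     (if \<Phi> x < \<infinity>
      then {\<xi>. 0 \<le> Liminf (at x)
              (\<lambda>y. (\<Phi> y - \<Phi> x - ereal (blinfun_apply \<xi> (y - x))) / ereal (norm (y - x)))}
      else {})"


section \<open>Mirror flows\<close>

text \<open>Curves on the half-line are functions on all of the reals, restricted to nonnegative times.\<close>

definition locally_absolutely_continuous :: "(real \<Rightarrow> 'w::real_normed_vector) \<Rightarrow> bool" where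
  "locally_absolutely_continuous u \<longleftrightarrow>
     (\<exists>A :: real \<Rightarrow> real.
        (\<forall>T\<ge>0. set_integrable lborel {0..T} A) \<and>
        (\<forall>s t. 0 \<le> s \<and> s \<le> t \<longrightarrow> norm (u t - u s) \<le> set_lebesgue_integral lborel {s..t} A))"

definition mirror_flow ::
    "('v::real_normed_vector \<Rightarrow> real) \<Rightarrow> ('v \<Rightarrow> ereal) \<Rightarrow> 'v \<Rightarrow> (real \<Rightarrow> 'v) \<Rightarrow> bool" where
  "mirror_flow \<Psi> \<Phi> x\<^sub>0 x \<longleftrightarrow>
     x 0 = x\<^sub>0 \<and>
     locally_absolutely_continuous (\<lambda>t. gradient \<Psi> (x t)) \<and>
     (AE t in lborel. 0 < t \<longrightarrow>
        (\<exists>\<xi>\<in>frechet_subdifferential \<Phi> (x t).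
           ((\<lambda>s. gradient \<Psi> (x s)) has_vector_derivative - \<xi>) (at t)))"

end

theory Submission
  imports Defs "HOL-Library.Diagonal_Subsequence"
begin

text \<open>
  Minimizing movements: with step size \<open>\<tau> = 1/p\<close> let \<open>X (k+1)\<close> minimize \<open>\<Phi> + D (\<cdot>, X k) / \<tau>\<close>. The
  \<open>\<lambda>\<close>-convexity turns minimality into a discrete evolution variational inequality (EVI) for \<open>D (y, X k)\<close>;
  with \<open>y = x\<^sub>0\<close> it keeps the iterates bounded, hence in a compact set, and then the lower bound on
  \<open>D\<close> of the conjugate gives a bound on \<open>\<Sum> |u (k+1) - u k|\<^sup>2 / \<tau>\<close> for \<open>u = \<nabla>\<Psi> (X)\<close>. Along a
  diagonal subsequence \<open>u\<close> converges at all times.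

  The piecewise constant derivatives of \<open>u\<close>, integrated over Borel sets, converge to a vector measure
  of bounded variation. The Radon--Nikodym property provides its density, which is the a.e. derivative
  of the limit curve by a Lebesgue differentiation argument. The EVI passes to the limit, and
  differentiating it gives the inclusion in the subdifferential.
\<close>

section \<open>Averages of integrable functions\<close>

text \<open>The dual may be nonseparable, and absolute continuity of a curve in it does not by
  itself yield a derivative; differentiability has to come from the Radon-Nikodym property, which
  speaks about vector measures. Instead of extending the increments of the limit curve to a measure,
  the proof extends convergence: each approximating measure is an explicit finite sum, and
  Cauchy-Schwarz bounds all of them by \<open>C * sqrt (measure M A)\<close> with the same
  \<open>C\<close>. This uniform continuity lets a Dynkin argument carry convergence from half-lines
  to all Borel sets.

  The exponent 2 in the energy comes from the quadratic bound on the divergence of the conjugate and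
  is independent of \<alpha>. Compactness is available in the primal space, regularity in time only
  for the gradients in the dual; coercivity of the divergence makes the inverse of the gradient map
  uniformly continuous and links the two.

  In the EVI the value of \<Phi> at the new iterate enters with a negative sign, so lower bounds on
  it, which lower semicontinuity supplies, are enough for the limit.\<close>

lemma Vitali_upper_density_negligible:
  fixes f :: "real \<Rightarrow> real"
  assumes f: "integrable lborel f" and nn: "\<And>t. 0 \<le> f t" and p: "0 \<le> p" and pq: "p < q"
  shows "negligible {t. \<bar>t\<bar> < N \<and> f t < p \<and>
    (\<forall>d>0. \<exists>a b. a < b \<and> a \<le> t \<and> t \<le> b \<and> b - a < d \<and> q * (b - a) < (LBINT x:{a..b}. f x))}"
    (is "negligible ?E")
  unfolding negligible_outer_le
proof (intro allI impI)
  fix e :: real assume e: "0 < e"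
  define \<nu> where "\<nu> = density lborel (\<lambda>t. ennreal (f t))"
  have fm[measurable]: "f \<in> borel_measurable borel"
    using borel_measurable_integrable[OF f] by simp
  have s\<nu>[simp]: "sets \<nu> = sets borel" "space \<nu> = UNIV" by (auto simp: \<nu>_def)
  have em\<nu>: "emeasure \<nu> A = (\<integral>\<^sup>+t\<in>A. ennreal (f t) \<partial>lborel)" if "A \<in> sets borel" for A
    using that by (simp add: \<nu>_def emeasure_density)
  have \<nu>int: "emeasure \<nu> {a..b} = ennreal (LBINT x:{a..b}. f x)" for a b
  proof -
    have "integrable lborel (\<lambda>x. indicator {a..b} x * f x)"
      using integrable_mult_indicator[OF _ f, of "{a..b}"] by simp
    then show ?thesis
      unfolding em\<nu>[OF borel_closed[OF closed_atLeastAtMost]] set_lebesgue_integral_def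
      by (subst nn_integral_eq_integral[symmetric])
         (auto simp: nn intro!: nn_integral_cong split: split_indicator)
  qed
  have \<nu>fin: "emeasure \<nu> (space \<nu>) \<noteq> \<infinity>"
    using f nn by (simp add: em\<nu> nn_integral_eq_integral)
  define H where "H = {t. \<bar>t\<bar> < N \<and> f t < p}"
  have Hs[measurable]: "H \<in> sets borel" unfolding H_def by measurable
  define e' where "e' = e * (q - p)"
  have e': "e' > 0" using e pq by (simp add: e'_def)
  have \<nu>Hfin: "emeasure \<nu> H \<noteq> \<infinity>"
    using \<nu>fin emeasure_mono[of H UNIV \<nu>] by (auto simp: top_unique)
  \<comment> \<open>Outer regularity is applied to \<open>\<nu>\<close>, not to Lebesgue measure:
    what the covering intervals can gain outside \<open>H\<close> is mass of \<open>\<nu>\<close>.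
    The slack \<open>e'\<close> is chosen so that dividing by \<open>q - p\<close> at the end
    returns \<open>e\<close>.\<close>
  have "(INF U \<in> {U. H \<subseteq> U \<and> open U}. emeasure \<nu> U) < emeasure \<nu> H + ennreal e'"
    using outer_regular[of \<nu> H] \<nu>fin e' \<nu>Hfin
    ennreal_add_left_cancel_less[of "emeasure \<nu> H" 0 "ennreal e'"]
    by auto
  then obtain U where U: "H \<subseteq> U" "open U" "emeasure \<nu> U < emeasure \<nu> H + ennreal e'"
    by (auto simp: INF_less_iff)
  have Us[measurable]: "U \<in> sets borel" using U by auto
  have \<nu>UH: "emeasure \<nu> (U - H) \<le> ennreal e'"
  proof -
    have "emeasure \<nu> H + emeasure \<nu> (U - H) = emeasure \<nu> U"
      using U by (subst plus_emeasure) (auto simp: Un_absorb1)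
    then have "emeasure \<nu> H + emeasure \<nu> (U - H) \<le> emeasure \<nu> H + ennreal e'"
      using U by simp
    then show ?thesis using \<nu>Hfin by (auto simp: ennreal_add_left_cancel_le)
  qed
  \<comment> \<open>The cut to a bounded interval makes the Lebesgue measure of \<open>W\<close>
    finite, which the final cancellation needs.\<close>
  define V where "V = U \<inter> {-N<..<N}"
  have V: "open V" "H \<subseteq> V" "V \<subseteq> {-N<..<N}" using U by (auto simp: V_def H_def)
  \<comment> \<open>The admissible intervals need not be centred at \<open>t\<close>; the covering
    theorem only asks that \<open>t\<close> lie in them. Centre and radius merely rewrite them as
    balls.\<close>
  define K where "K = {(a,b). a < b \<and> {a..b} \<subseteq> V \<and> q * (b - a) < (LBINT x:{a..b}. f x)}"
  define c where "c = (\<lambda>(a::real,b). (a + b) / 2)"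
  define r where "r = (\<lambda>(a::real,b). (b - a) / 2)"
  define I where "I = (\<lambda>(a::real,b). {a..b})"
  have cb: "cball (c i) (r i) = I i" for i
    by (cases i) (auto simp: c_def r_def I_def cball_eq_atLeastAtMost field_simps)
  have "\<exists>C. countable C \<and> C \<subseteq> K \<and> pairwise (\<lambda>i j. disjnt (cball (c i) (r i)) (cball (c j) (r j))) C
     \<and> negligible (?E - (\<Union>i\<in>C. cball (c i) (r i)))"
  proof (rule Vitali_covering_theorem_cballs[of K r ?E c])
    show "0 < r i" if "i \<in> K" for i using that by (auto simp: K_def r_def)
    fix t d :: real assume t: "t \<in> ?E" and d: "0 < d"
    then have "t \<in> V" using V by (auto simp: H_def)
    then obtain \<delta> where \<delta>: "\<delta> > 0" "ball t \<delta> \<subseteq> V" using V by (meson open_contains_ball)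
    from t have "\<forall>d>0. \<exists>a b. a < b \<and> a \<le> t \<and> t \<le> b \<and> b - a < d \<and> q * (b - a) < (LBINT x:{a..b}. f x)"
      by blast
    moreover have "0 < min d \<delta>" using d \<delta> by simp
    ultimately obtain a b where ab: "a < b" "a \<le> t" "t \<le> b" "b - a < min d \<delta>"
      "q * (b - a) < (LBINT x:{a..b}. f x)" by blast
    have "{a..b} \<subseteq> ball t \<delta>" using ab by (auto simp: dist_real_def)
    then have "(a,b) \<in> K" using ab \<delta> by (auto simp: K_def)
    moreover have "t \<in> cball (c (a,b)) (r (a,b))" using ab unfolding cb by (simp add: I_def)
    moreover have "r (a,b) < d" using ab by (simp add: r_def)
    ultimately show "\<exists>i. i \<in> K \<and> t \<in> cball (c i) (r i) \<and> r i < d" by blast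
  qed blast
  then obtain C where C: "countable C" "C \<subseteq> K" "pairwise (\<lambda>i j. disjnt (I i) (I j)) C"
    "negligible (?E - (\<Union>i\<in>C. I i))"
    by (auto simp: cb)
  define W where "W = (\<Union>i\<in>C. I i)"
  have Im[measurable]: "I i \<in> sets borel" for i by (cases i) (auto simp: I_def)
  have Wm[measurable]: "W \<in> sets borel" unfolding W_def using C(1) by auto
  have WV: "W \<subseteq> V" using C(2) by (auto simp: W_def K_def I_def)
  have WN: "emeasure lborel W \<noteq> \<infinity>"
  proof -
    have "emeasure lborel W \<le> emeasure lborel {-N<..<N}"
      using WV V by (intro emeasure_mono) auto
    moreover have "emeasure lborel {-N<..<N} < \<infinity>"
      by (cases "-N \<le> N") auto
    ultimately show ?thesis by auto
  qed
  have dj: "disjoint_family_on I C"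
    using C(3) by (auto simp: disjoint_family_on_def pairwise_def disjnt_def)
  \<comment> \<open>Two estimates of the mass of \<open>W\<close> compete: the averages exceed
    \<open>q\<close> on each disjoint interval, while the density is below \<open>p\<close> on
    \<open>H\<close> and \<open>W - H\<close> has mass at most \<open>e'\<close>.\<close>
  have "ennreal q * emeasure lborel W = (\<integral>\<^sup>+i. ennreal q * emeasure lborel (I i) \<partial>count_space C)"
    unfolding W_def using C(1) dj
    by (subst emeasure_UN_countable) (auto simp: nn_integral_cmult)
  also have "\<dots> \<le> (\<integral>\<^sup>+i. emeasure \<nu> (I i) \<partial>count_space C)"
  proof (rule nn_integral_mono)
    fix i assume "i \<in> space (count_space C)"
    then have "i \<in> K" using C by auto
    then show "ennreal q * emeasure lborel (I i) \<le> emeasure \<nu> (I i)"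
      using p pq by (auto simp: K_def I_def \<nu>int ennreal_mult[symmetric] intro!: ennreal_leI)
  qed
  also have "\<dots> = emeasure \<nu> W"
    unfolding W_def using C(1) dj by (subst emeasure_UN_countable) auto
  also have "\<dots> \<le> emeasure \<nu> (W \<inter> H) + emeasure \<nu> (W - H)"
    by (subst plus_emeasure) (auto intro!: emeasure_mono)
  also have "\<dots> \<le> ennreal p * emeasure lborel W + ennreal e'"
  proof (rule add_mono)
    have "emeasure \<nu> (W \<inter> H) \<le> (\<integral>\<^sup>+t. ennreal p * indicator W t \<partial>lborel)"
      unfolding em\<nu>[OF sets.Int[OF Wm Hs]]
      by (rule nn_integral_mono) (auto simp: H_def intro!: ennreal_leI split: split_indicator)
    then show "emeasure \<nu> (W \<inter> H) \<le> ennreal p * emeasure lborel W"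
      by (simp add: nn_integral_cmult)
    have "emeasure \<nu> (W - H) \<le> emeasure \<nu> (U - H)"
      using WV by (intro emeasure_mono) (auto simp: V_def)
    with \<nu>UH show "emeasure \<nu> (W - H) \<le> ennreal e'" by simp
  qed
  finally have "ennreal q * emeasure lborel W \<le> ennreal p * emeasure lborel W + ennreal e'" .
  moreover have "emeasure lborel W = ennreal (measure lborel W)"
    using WN by (simp add: emeasure_eq_ennreal_measure)
  ultimately have "q * measure lborel W \<le> p * measure lborel W + e'"
    using p pq e' by (simp add: ennreal_mult[symmetric] ennreal_plus[symmetric] del: ennreal_plus)
  then have "(q - p) * measure lborel W \<le> (q - p) * e" by (simp add: e'_def algebra_simps)
  then have mW: "measure lborel W \<le> e" using pq by simp
  have Wl: "W \<in> lmeasurable" using WN by (auto simp: fmeasurable_def less_top)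
  have nE: "negligible (?E - W)" using C(4) by (simp add: W_def)
  show "\<exists>T. ?E \<subseteq> T \<and> T \<in> lmeasurable \<and> measure lebesgue T \<le> e"
  proof (intro exI conjI)
    show "?E \<subseteq> W \<union> (?E - W)" by auto
    show "W \<union> (?E - W) \<in> lmeasurable"
      using Wl nE by (intro fmeasurable.Un) (auto simp: negligible_imp_measurable)
    show "measure lebesgue (W \<union> (?E - W)) \<le> e"
      using measure_Un_le[of W lebesgue "?E - W"] Wl nE mW
      by (simp add: negligible_imp_measure0 negligible_imp_sets)
  qed
qed

lemma AE_lborel_if_negligible:
  fixes P :: "real \<Rightarrow> bool"
  assumes "negligible {t. \<not> P t}"
  shows "AE t in lborel. P t"
proof -
  have "{t. \<not> P t} \<in> null_sets lebesgue" using assms by (simp add: negligible_iff_null_sets)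
  then have "AE t in lebesgue. P t" by (intro AE_I') auto
  then show ?thesis by (simp add: AE_completion_iff)
qed

text \<open>One-sided form of the Lebesgue differentiation theorem: for \<open>f = (\<lambda>s. norm (g s - z))\<close> an upper
  bound of the averages already controls the difference quotients of the integral of \<open>g\<close>.\<close>

lemma AE_average_le:
  fixes f :: "real \<Rightarrow> real"
  assumes f: "integrable lborel f" and nn: "\<And>t. 0 \<le> f t"
  shows "AE t in lborel. \<forall>e>0. \<exists>d>0. \<forall>a b. a < b \<and> a \<le> t \<and> t \<le> b \<and> b - a < d \<longrightarrow>
    (LBINT x:{a..b}. f x) \<le> (f t + e) * (b - a)"
proof (rule AE_lborel_if_negligible)
  let ?B = "\<lambda>N p q. {t. \<bar>t\<bar> < N \<and> f t < p \<and>
    (\<forall>d>0. \<exists>a b. a < b \<and> a \<le> t \<and> t \<le> b \<and> b - a < d \<and> q * (b - a) < (LBINT x:{a..b}. f x))}"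
  \<comment> \<open>Rational parameters reduce the exceptional set to countably many sets of the
    previous lemma, since rationals \<open>p < q\<close> fit between \<open>f t\<close> and
    \<open>f t + e\<close>.\<close>
  define J where "J = {(N::real,p,q). N \<in> \<rat> \<and> p \<in> \<rat> \<and> q \<in> \<rat> \<and> (0::real) \<le> p \<and> p < (q::real)}"
  have "J \<subseteq> \<rat> \<times> \<rat> \<times> \<rat>" by (auto simp: J_def)
  then have cJ: "countable J" by (rule countable_subset) (auto simp: countable_rat)
  have "negligible (\<Union>j\<in>J. (\<lambda>(N,p,q). ?B N p q) j)"
    using Vitali_upper_density_negligible[OF f nn]
    by (intro negligible_countable_Union countable_image cJ) (auto simp: J_def)
  moreover have "{t. \<not> (\<forall>e>0. \<exists>d>0. \<forall>a b. a < b \<and> a \<le> t \<and> t \<le> b \<and> b - a < d \<longrightarrow>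
    (LBINT x:{a..b}. f x) \<le> (f t + e) * (b - a))} \<subseteq> (\<Union>j\<in>J. (\<lambda>(N,p,q). ?B N p q) j)"
  proof
    fix t assume "t \<in> {t. \<not> (\<forall>e>0. \<exists>d>0. \<forall>a b. a < b \<and> a \<le> t \<and> t \<le> b \<and> b - a < d \<longrightarrow>
      (LBINT x:{a..b}. f x) \<le> (f t + e) * (b - a))}"
    then obtain e where e: "e > 0" and
      *: "\<And>d. d > 0 \<Longrightarrow> \<exists>a b. a < b \<and> a \<le> t \<and> t \<le> b \<and> b - a < d \<and> (f t + e) * (b - a) < (LBINT x:{a..b}. f x)"
      by (auto simp: not_le)
    obtain N where N: "N \<in> \<rat>" "\<bar>t\<bar> < N" using Rats_dense_in_real[of "\<bar>t\<bar>" "\<bar>t\<bar> + 1"] by auto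
    obtain p where p: "p \<in> \<rat>" "f t < p" "p < f t + e/2" using Rats_dense_in_real[of "f t" "f t + e/2"] e by auto
    obtain q where q: "q \<in> \<rat>" "f t + e/2 < q" "q < f t + e"
      using Rats_dense_in_real[of "f t + e/2" "f t + e"] e by auto
    have "(N,p,q) \<in> J" using N p q nn[of t] by (auto simp: J_def)
    moreover have "t \<in> ?B N p q"
    proof -
      have "\<exists>a b. a < b \<and> a \<le> t \<and> t \<le> b \<and> b - a < d \<and> q * (b - a) < (LBINT x:{a..b}. f x)" if "d > 0" for d
      proof -
        from *[OF that] obtain a b where ab: "a < b" "a \<le> t" "t \<le> b" "b - a < d"
          "(f t + e) * (b - a) < (LBINT x:{a..b}. f x)" by blast
        moreover have "q * (b - a) \<le> (f t + e) * (b - a)" using q ab by (intro mult_right_mono) auto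
        ultimately show ?thesis by (meson le_less_trans)
      qed
      then show ?thesis using N p by auto
    qed
    ultimately show "t \<in> (\<Union>j\<in>J. (\<lambda>(N,p,q). ?B N p q) j)"
      by (intro UN_I[of "(N,p,q)"]) (simp_all only: prod.case)
  qed
  ultimately show "negligible {t. \<not> (\<forall>e>0. \<exists>d>0. \<forall>a b. a < b \<and> a \<le> t \<and> t \<le> b \<and> b - a < d \<longrightarrow>
    (LBINT x:{a..b}. f x) \<le> (f t + e) * (b - a))}"
    by (rule negligible_subset)
qed

section \<open>Bochner densities of curves\<close>

text \<open>In a nonseparable space the difference of two Borel functions can fail to be Borel. A
  simple function has finitely many values, so measurability can be checked on each of its level
  sets.\<close>

lemma borel_measurable_norm_diff_simple:
  fixes f s :: "'a \<Rightarrow> 'b::real_normed_vector"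
  assumes f: "f \<in> borel_measurable M" and s: "simple_function M s"
  shows "(\<lambda>x. norm (f x - s x)) \<in> borel_measurable M"
proof (rule measurable_compose_countable'[where g=s and I="s ` space M" and f="\<lambda>z x. norm (f x - z)"])
  show "(\<lambda>x. norm (f x - z)) \<in> borel_measurable M" for z
    using f by (rule measurable_compose) (intro borel_measurable_continuous_onI continuous_intros)
  show "s \<in> measurable M (count_space (s ` space M))"
    using measurable_simple_function[OF s] simple_functionD(1)[OF s]
    by (auto simp: measurable_count_space_eq2 simple_functionD[OF s])
  show "countable (s ` space M)" using simple_functionD(1)[OF s] by (rule countable_finite)
qed

lemma has_bochner_intE:
  assumes "has_bochner_int M f I"
  obtains s where "f \<in> borel_measurable M"
    "\<And>i::nat. Bochner_Integration.simple_bochner_integrable M (s i)" "\<And>i. simple_function M (s i)"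
    "\<And>i. (\<lambda>x. norm (f x - s i x)) \<in> borel_measurable M"
    "(\<lambda>i. \<integral>\<^sup>+x. norm (f x - s i x) \<partial>M) \<longlonglongrightarrow> 0"
    "(\<lambda>i. Bochner_Integration.simple_bochner_integral M (s i)) \<longlonglongrightarrow> I"
proof -
  from assms obtain s where s: "f \<in> borel_measurable M"
    "\<And>i::nat. Bochner_Integration.simple_bochner_integrable M (s i)" 
    "(\<lambda>i. \<integral>\<^sup>+x. norm (f x - s i x) \<partial>M) \<longlonglongrightarrow> 0"
    "(\<lambda>i. Bochner_Integration.simple_bochner_integral M (s i)) \<longlonglongrightarrow> I"
    by (auto simp: has_bochner_int_def)
  moreover have "simple_function M (s i)" for i
    using s(2)[of i] by (auto elim: Bochner_Integration.simple_bochner_integrable.cases)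
  ultimately show ?thesis using that borel_measurable_norm_diff_simple by blast
qed

lemma has_bochner_int_norm_finite:
  assumes "has_bochner_int M f I"
  shows "(\<integral>\<^sup>+x. norm (f x) \<partial>M) < \<infinity>"
proof -
  obtain s where s: "f \<in> borel_measurable M"
    "\<And>i::nat. Bochner_Integration.simple_bochner_integrable M (s i)" "\<And>i. simple_function M (s i)"
    "\<And>i. (\<lambda>x. norm (f x - s i x)) \<in> borel_measurable M"
    "(\<lambda>i. \<integral>\<^sup>+x. norm (f x - s i x) \<partial>M) \<longlonglongrightarrow> 0"
    "(\<lambda>i. Bochner_Integration.simple_bochner_integral M (s i)) \<longlonglongrightarrow> I"
    by (rule has_bochner_intE[OF assms]) (rule that, assumption+)
  have "eventually (\<lambda>i. (\<integral>\<^sup>+x. norm (f x - s i x) \<partial>M) < 1) sequentially"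
    using s(5) by (rule order_tendstoD) simp
  then obtain i where i: "(\<integral>\<^sup>+x. norm (f x - s i x) \<partial>M) < 1"
    by (auto simp: eventually_sequentially)
  have n: "Bochner_Integration.simple_bochner_integrable M (\<lambda>x. norm (s i x))"
    using Bochner_Integration.simple_bochner_integrable_compose2[of "\<lambda>x y. norm x" M "s i" "s i"] s(2) by simp
  have fin: "(\<integral>\<^sup>+x. norm (s i x) \<partial>M) < \<infinity>"
    using Bochner_Integration.simple_bochner_integral_eq_nn_integral[OF n] by (metis ennreal_less_top infinity_ennreal_def norm_ge_zero)
  have [measurable]: "(\<lambda>x. norm (s i x)) \<in> borel_measurable M"
    using simple_function_compose1[OF s(3)[of i], of norm] by (rule borel_measurable_simple_function)
  note s(4)[measurable]
  have "(\<integral>\<^sup>+x. norm (f x) \<partial>M) \<le> (\<integral>\<^sup>+x. ennreal (norm (f x - s i x)) + ennreal (norm (s i x)) \<partial>M)"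
    by (intro nn_integral_mono, subst ennreal_plus[symmetric])
       (simp_all del: ennreal_plus, metis diff_add_cancel norm_triangle_ineq)
  also have "\<dots> = (\<integral>\<^sup>+x. norm (f x - s i x) \<partial>M) + (\<integral>\<^sup>+x. norm (s i x) \<partial>M)"
    by (rule nn_integral_add) auto
  also have "\<dots> < \<infinity>" using i fin by (auto simp: less_top[symmetric])
  finally show ?thesis .
qed

text \<open>The values of the approximating simple functions form a countable set, and convergence
  in mean puts almost every value of \<open>f\<close> in its closure. This separability replaces
  that of the whole space in the differentiation argument.\<close>

lemma has_bochner_int_separably_valued:
  fixes f :: "'a \<Rightarrow> 'b::real_normed_vector"
  assumes "has_bochner_int M f I"
  obtains D where "countable D" "AE x in M. f x \<in> closure D"
proof -
  obtain s where s: "f \<in> borel_measurable M"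
    "\<And>i::nat. Bochner_Integration.simple_bochner_integrable M (s i)" "\<And>i. simple_function M (s i)"
    "\<And>i. (\<lambda>x. norm (f x - s i x)) \<in> borel_measurable M"
    "(\<lambda>i. \<integral>\<^sup>+x. norm (f x - s i x) \<partial>M) \<longlonglongrightarrow> 0"
    "(\<lambda>i. Bochner_Integration.simple_bochner_integral M (s i)) \<longlonglongrightarrow> I"
    by (rule has_bochner_intE[OF assms]) (rule that, assumption+)
  note [measurable] = s(4)
  define D where "D = (\<Union>i. s i ` space M)"
  have "countable D"
    unfolding D_def using simple_functionD(1)[OF s(3)] by (auto intro: countable_finite)
  moreover have "AE x in M. \<forall>k::nat. \<exists>i. norm (f x - s i x) < 1 / Suc k"
    unfolding AE_all_countable
  proof
    fix k :: nat
    let ?B = "{x\<in>space M. \<forall>i. 1 / Suc k \<le> norm (f x - s i x)}"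
    \<comment> \<open>Markov's inequality bounds the set of points far from all \<open>s i\<close>
      at once. Its left side does not depend on \<open>i\<close>, so \<open>i\<close> may tend to
      infinity without extracting an almost everywhere convergent subsequence.\<close>
    have "emeasure M ?B \<le> ennreal (Suc k) * (\<integral>\<^sup>+x. norm (f x - s i x) \<partial>M)" for i
    proof -
      have "emeasure M ?B \<le> emeasure M {x\<in>space M. 1 \<le> ennreal (Suc k) * ennreal (norm (f x - s i x))}"
      proof (rule emeasure_mono)
        show "?B \<subseteq> {x\<in>space M. 1 \<le> ennreal (Suc k) * ennreal (norm (f x - s i x))}"
        proof
          fix x assume x: "x \<in> ?B"
          then have "1 / real (Suc k) \<le> norm (f x - s i x)" by blast
          then have "1 \<le> real (Suc k) * norm (f x - s i x)" by (simp add: field_simps)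
          then have "ennreal 1 \<le> ennreal (real (Suc k) * norm (f x - s i x))" by (rule ennreal_leI)
          then show "x \<in> {x\<in>space M. 1 \<le> ennreal (Suc k) * ennreal (norm (f x - s i x))}"
            using x by (simp add: ennreal_mult)
        qed
      qed measurable
      also have "\<dots> \<le> ennreal (Suc k) * (\<integral>\<^sup>+x. ennreal (norm (f x - s i x)) * indicator (space M) x \<partial>M)"
        using nn_integral_Markov_inequality[of "\<lambda>x. ennreal (norm (f x - s i x))" "space M" M "ennreal (Suc k)"]
        by simp
      also have "(\<integral>\<^sup>+x. ennreal (norm (f x - s i x)) * indicator (space M) x \<partial>M) = (\<integral>\<^sup>+x. norm (f x - s i x) \<partial>M)"
        by (auto intro!: nn_integral_cong)
      finally show ?thesis .
    qed
    moreover have "(\<lambda>i. ennreal (Suc k) * (\<integral>\<^sup>+x. norm (f x - s i x) \<partial>M)) \<longlonglongrightarrow> ennreal (Suc k) * 0"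
      using s(5) by (intro ennreal_tendsto_cmult) auto
    ultimately have "emeasure M ?B \<le> ennreal (Suc k) * 0"
      by (intro tendsto_lowerbound[where F=sequentially]) auto
    then have "emeasure M ?B = 0" by simp
    moreover have "?B \<in> sets M" by measurable
    ultimately have "?B \<in> null_sets M" by (simp add: null_setsI)
    then show "AE x in M. \<exists>i. norm (f x - s i x) < 1 / Suc k"
      by (rule AE_I') (auto simp: not_less)
  qed
  then have "AE x in M. f x \<in> closure D"
  proof (rule AE_mp, intro AE_I2 impI)
    fix x assume x: "x \<in> space M" and *: "\<forall>k::nat. \<exists>i. norm (f x - s i x) < 1 / Suc k"
    show "f x \<in> closure D"
      unfolding closure_approachable
    proof (intro allI impI)
      fix e :: real assume "0 < e"
      then obtain k where "1 / Suc k < e" using nat_approx_posE by blast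
      moreover obtain i where "norm (f x - s i x) < 1 / Suc k" using * by blast
      ultimately show "\<exists>y\<in>D. dist y (f x) < e"
        using x by (intro bexI[of _ "s i x"]) (auto simp: D_def dist_norm norm_minus_commute)
    qed
  qed
  ultimately show ?thesis by (rule that)
qed

text \<open>Norm inequality for the integral of \<open>g - z\<close> over \<open>A\<close>, obtained
  by comparing the approximating simple functions with the simple function \<open>z\<close> on
  \<open>A\<close>. The free constant \<open>z\<close> is what the differentiation argument
  varies.\<close>

lemma has_bochner_int_norm_diff_le:
  fixes g :: "'a \<Rightarrow> 'b::real_normed_vector"
  assumes M: "finite_measure M" and A: "A \<in> sets M"
    and g: "has_bochner_int M (\<lambda>x. indicator A x *\<^sub>R g x) I"
  shows "ennreal (norm (I - measure M A *\<^sub>R z)) \<le> (\<integral>\<^sup>+x. indicator A x * norm (g x - z) \<partial>M)"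
proof -
  interpret finite_measure M by fact
  note [measurable] = A
  let ?f = "\<lambda>x. indicator A x *\<^sub>R g x" and ?T = "\<lambda>x. indicator A x *\<^sub>R z"
  from has_bochner_intE[OF g] obtain s where s: "?f \<in> borel_measurable M"
    "\<And>i::nat. Bochner_Integration.simple_bochner_integrable M (s i)" "\<And>i. simple_function M (s i)"
    "\<And>i. (\<lambda>x. norm (?f x - s i x)) \<in> borel_measurable M"
    "(\<lambda>i. \<integral>\<^sup>+x. norm (?f x - s i x) \<partial>M) \<longlonglongrightarrow> 0" 
    "(\<lambda>i. Bochner_Integration.simple_bochner_integral M (s i)) \<longlonglongrightarrow> I" by blast
  have ind: "Bochner_Integration.simple_bochner_integrable M (indicator A :: _ \<Rightarrow> real)"
    by (intro Bochner_Integration.simple_bochner_integrable.intros) (auto intro!: simple_function_indicator)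
  have T: "Bochner_Integration.simple_bochner_integrable M ?T"
    using Bochner_Integration.simple_bochner_integrable_compose2[of "\<lambda>x y. x *\<^sub>R z" M "indicator A" "indicator A"] ind by simp
  have Tm: "simple_function M ?T"
    using T by (auto elim: Bochner_Integration.simple_bochner_integrable.cases)
  have "measure M A = Bochner_Integration.simple_bochner_integral M (indicator A :: _ \<Rightarrow> real)"
    using Bochner_Integration.simple_bochner_integral_eq_nn_integral[OF ind] 
    by (simp add: ennreal_indicator emeasure_eq_measure)
  then have IT: "Bochner_Integration.simple_bochner_integral M ?T = measure M A *\<^sub>R z"
    using Bochner_Integration.simple_bochner_integral_linear[of "\<lambda>r. r *\<^sub>R z" M "indicator A"] ind
    by (simp add: linear_iff scaleR_add_left)
  have [measurable]: "(\<lambda>x. norm (?f x - ?T x)) \<in> borel_measurable M"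
    using borel_measurable_norm_diff_simple[OF s(1) Tm] .
  note [measurable] = s(4)
  let ?J = "\<integral>\<^sup>+x. indicator A x * norm (g x - z) \<partial>M"
  have le: "ennreal (norm (Bochner_Integration.simple_bochner_integral M (s i) - measure M A *\<^sub>R z))
     \<le> (\<integral>\<^sup>+x. norm (?f x - s i x) \<partial>M) + ?J" for i
  proof -
    have "ennreal (norm (Bochner_Integration.simple_bochner_integral M (s i) - measure M A *\<^sub>R z))
      = norm (Bochner_Integration.simple_bochner_integral M (\<lambda>x. s i x - ?T x))"
      using s(2) T by (subst Bochner_Integration.simple_bochner_integral_diff) (auto simp: IT)
    also have "\<dots> \<le> Bochner_Integration.simple_bochner_integral M (\<lambda>x. norm (s i x - ?T x))"
      using Bochner_Integration.simple_bochner_integrable_compose2[of "(-)" M "s i" "?T"] s(2) T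
      by (auto intro!: Bochner_Integration.simple_bochner_integral_norm_bound)
    also have "\<dots> = (\<integral>\<^sup>+x. norm (s i x - ?T x) \<partial>M)"
      using Bochner_Integration.simple_bochner_integrable_compose2[of "\<lambda>x y. norm (x - y)" M "s i" "?T"] s(2) T
      by (auto intro!: Bochner_Integration.simple_bochner_integral_eq_nn_integral)
    also have "\<dots> \<le> (\<integral>\<^sup>+x. ennreal (norm (?f x - s i x)) + ennreal (norm (?f x - ?T x)) \<partial>M)"
    proof (rule nn_integral_mono)
      fix x show "ennreal (norm (s i x - ?T x)) \<le> ennreal (norm (?f x - s i x)) + ennreal (norm (?f x - ?T x))"
        using norm_triangle_ineq[of "s i x - ?f x" "?f x - ?T x"]
        by (simp add: ennreal_plus[symmetric] norm_minus_commute del: ennreal_plus)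
    qed
    also have "\<dots> = (\<integral>\<^sup>+x. norm (?f x - s i x) \<partial>M) + (\<integral>\<^sup>+x. norm (?f x - ?T x) \<partial>M)"
      by (rule nn_integral_add) auto
    also have "(\<integral>\<^sup>+x. norm (?f x - ?T x) \<partial>M) = ?J"
      by (auto intro!: nn_integral_cong split: split_indicator)
    finally show ?thesis .
  qed
  have "(\<lambda>i. (\<integral>\<^sup>+x. norm (?f x - s i x) \<partial>M) + ?J) \<longlonglongrightarrow> 0 + ?J"
    by (intro tendsto_add s(5) tendsto_const)
  then have lim: "(\<lambda>i. (\<integral>\<^sup>+x. norm (?f x - s i x) \<partial>M) + ?J) \<longlonglongrightarrow> ?J" by simp
  have "(\<lambda>i. ennreal (norm (Bochner_Integration.simple_bochner_integral M (s i) - measure M A *\<^sub>R z)))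
    \<longlonglongrightarrow> ennreal (norm (I - measure M A *\<^sub>R z))"
    by (intro tendsto_ennrealI tendsto_intros s(6))
  from tendsto_le[OF trivial_limit_sequentially lim this always_eventually[OF allI, OF le]]
  show ?thesis .
qed

text \<open>The vector-valued Lebesgue theorem reduces to the scalar one: the latter is applied to
  \<open>norm (g x - z)\<close> for all \<open>z\<close> in a countable set whose closure contains
  almost all values of \<open>g\<close>, and at a given time \<open>z\<close> is then taken close to
  \<open>g t\<close>.\<close>

lemma has_vector_derivative_if_density:
  fixes u g :: "real \<Rightarrow> 'b::real_normed_vector"
  assumes M: "M = density lborel (indicator {0..S})"
    and F: "\<And>A. A \<in> sets M \<Longrightarrow> has_bochner_int M (\<lambda>x. indicator A x *\<^sub>R g x) (F A)"
    and u: "\<And>s t. 0 \<le> s \<Longrightarrow> s \<le> t \<Longrightarrow> t \<le> S \<Longrightarrow> F {s<..t} = u t - u s"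
  shows "g \<in> borel_measurable borel"
    and "set_integrable lborel {0..S} (\<lambda>x. norm (g x))"
    and "\<And>s t. 0 \<le> s \<Longrightarrow> s \<le> t \<Longrightarrow> t \<le> S \<Longrightarrow> norm (u t - u s) \<le> (LBINT x:{s..t}. norm (g x))"
    and "AE t in lborel. 0 < t \<and> t < S \<longrightarrow> (u has_vector_derivative g t) (at t)"
proof -
  have sM[simp]: "sets M = sets borel" "space M = UNIV" by (auto simp: M)
  have emM: "emeasure M A = emeasure lborel (A \<inter> {0..S})" if "A \<in> sets borel" for A
    using that unfolding M
    by (subst emeasure_density)
       (auto simp: nn_integral_indicator[symmetric] simp del: nn_integral_indicator
             intro!: nn_integral_cong split: split_indicator)
  have fM: "finite_measure M"
    by standard (cases "0 \<le> S"; simp add: emM)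
  have U: "has_bochner_int M g (F UNIV)" using F[of UNIV] by simp
  then show gm[measurable]: "g \<in> borel_measurable borel"
    by (auto simp: has_bochner_int_def M)
  have gz[measurable]: "(\<lambda>x. norm (g x - z)) \<in> borel_measurable borel" for z
    using gm by (rule measurable_compose) (intro borel_measurable_continuous_onI continuous_intros)
  have nnM: "(\<integral>\<^sup>+x. f x \<partial>M) = (\<integral>\<^sup>+x. indicator {0..S} x * f x \<partial>lborel)"
    if "f \<in> borel_measurable borel" for f :: "real \<Rightarrow> ennreal"
    using that unfolding M by (subst nn_integral_density) auto
  have "(\<integral>\<^sup>+x. ennreal (norm (g x)) \<partial>M) < \<infinity>" by (rule has_bochner_int_norm_finite[OF U])
  then have "(\<integral>\<^sup>+x. ennreal (indicator {0..S} x * norm (g x)) \<partial>lborel) < \<infinity>"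
    by (subst (asm) nnM) (auto simp: ennreal_mult ennreal_indicator[symmetric])
  then have int0: "integrable lborel (\<lambda>x. indicator {0..S} x * norm (g x))"
    by (intro integrableI_nonneg) auto
  then show gi: "set_integrable lborel {0..S} (\<lambda>x. norm (g x))"
    by (simp add: set_integrable_def)
  \<comment> \<open>The cut to \<open>{0..S}\<close> makes the function integrable on the whole line
    even though the constant \<open>z\<close> is not.\<close>
  define f where "f = (\<lambda>z x. indicator {0..S} x * norm (g x - z))"
  have fint: "integrable lborel (f z)" for z
  proof (rule Bochner_Integration.integrable_bound)
    show "integrable lborel (\<lambda>x. indicator {0..S} x * norm (g x) + indicator {0..S} x * norm z)"
      using int0 by (intro Bochner_Integration.integrable_add integrable_mult_left) (cases "0 \<le> S"; simp)+
    show "f z \<in> borel_measurable lborel" by (simp add: f_def)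
    show "AE x in lborel. norm (f z x) \<le> norm (indicator {0..S} x * norm (g x) + indicator {0..S} x * norm z)"
      by (auto simp: f_def norm_triangle_ineq4 split: split_indicator intro!: AE_I2)
  qed
  have bound: "norm (u t - u s - (t - s) *\<^sub>R z) \<le> (LBINT x:{s..t}. f z x)"
    if st: "0 \<le> s" "s \<le> t" "t \<le> S" for s t z
  proof -
    have m: "measure M {s<..t} = t - s"
    proof -
      have "{s<..t} \<inter> {0..S} = {s<..t}" using st by auto
      then show ?thesis using st by (simp add: measure_def emM)
    qed
    have "ennreal (norm (F {s<..t} - measure M {s<..t} *\<^sub>R z)) \<le> (\<integral>\<^sup>+x. indicator {s<..t} x * norm (g x - z) \<partial>M)"
      by (rule has_bochner_int_norm_diff_le[OF fM _ F]) auto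
    also have "\<dots> = (\<integral>\<^sup>+x. indicator {0..S} x * ennreal (indicator {s<..t} x * norm (g x - z)) \<partial>lborel)"
      by (subst nnM) auto
    also have "\<dots> \<le> (\<integral>\<^sup>+x. ennreal (indicator {s..t} x * f z x) \<partial>lborel)"
      by (intro nn_integral_mono) (auto simp: f_def split: split_indicator)
    also have "\<dots> = ennreal (LBINT x:{s..t}. f z x)"
      unfolding set_lebesgue_integral_def real_scaleR_def
      using integrable_mult_indicator[OF _ fint[of z], of "{s..t}"]
      by (intro nn_integral_eq_integral) (auto simp: f_def)
    finally have "ennreal (norm (u t - u s - (t - s) *\<^sub>R z)) \<le> ennreal (LBINT x:{s..t}. f z x)"
      by (simp add: m u st)
    moreover have "0 \<le> (LBINT x:{s..t}. f z x)"
      unfolding set_lebesgue_integral_def by (intro integral_nonneg_AE) (auto simp: f_def)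
    ultimately show ?thesis by (subst (asm) ennreal_le_iff)
  qed
  show "norm (u t - u s) \<le> (LBINT x:{s..t}. norm (g x))" if st: "0 \<le> s" "s \<le> t" "t \<le> S" for s t
  proof -
    have "(LBINT x:{s..t}. f 0 x) = (LBINT x:{s..t}. norm (g x))"
      using st unfolding set_lebesgue_integral_def
      by (intro Bochner_Integration.integral_cong) (auto simp: f_def split: split_indicator)
    then show ?thesis using bound[OF st, of 0] by simp
  qed
  obtain D where D: "countable D" "AE x in M. g x \<in> closure D"
    using has_bochner_int_separably_valued[OF U] by blast
  have "AE x in lborel. x \<in> {0..S} \<longrightarrow> g x \<in> closure D"
    using D(2) unfolding M by (subst (asm) AE_density) (auto simp: indicator_def)
  moreover have "AE t in lborel. \<forall>z\<in>D. \<forall>e>0. \<exists>d>0. \<forall>a b. a < b \<and> a \<le> t \<and> t \<le> b \<and> b - a < d \<longrightarrow>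
    (LBINT x:{a..b}. f z x) \<le> (f z t + e) * (b - a)"
    using D(1) fint by (subst AE_ball_countable) (auto intro!: AE_average_le simp: f_def)
  ultimately show "AE t in lborel. 0 < t \<and> t < S \<longrightarrow> (u has_vector_derivative g t) (at t)"
  proof (eventually_elim, intro impI)
    fix t assume cl: "t \<in> {0..S} \<longrightarrow> g t \<in> closure D" and t: "0 < t \<and> t < S"
      and av: "\<forall>z\<in>D. \<forall>e>0. \<exists>d>0. \<forall>a b. a < b \<and> a \<le> t \<and> t \<le> b \<and> b - a < d \<longrightarrow>
        (LBINT x:{a..b}. f z x) \<le> (f z t + e) * (b - a)"
    show "(u has_vector_derivative g t) (at t)"
      unfolding has_vector_derivative_def has_derivative_at_alt
    proof (intro conjI allI impI)
      show "bounded_linear (\<lambda>x. x *\<^sub>R g t)" by (rule bounded_linear_scaleR_left)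
      fix e :: real assume e: "0 < e"
      \<comment> \<open>Three thirds of \<open>e\<close>: the value \<open>f z t\<close>, the excess
        of the average over it, and the replacement of \<open>z\<close> by \<open>g t\<close> in the
        linear term.\<close>
      obtain z where z: "z \<in> D" "dist z (g t) < e/3"
        using cl t e by (auto simp: closure_approachable dest!: spec[of _ "e/3"])
      obtain d where d: "d > 0" "\<And>a b. a < b \<Longrightarrow> a \<le> t \<Longrightarrow> t \<le> b \<Longrightarrow> b - a < d \<Longrightarrow>
        (LBINT x:{a..b}. f z x) \<le> (f z t + e/3) * (b - a)"
        using bspec[OF av z(1), THEN spec, of "e/3"] e by auto
      have fz: "f z t \<le> e/3" using z(2) t by (simp add: f_def dist_norm norm_minus_commute)
      have key: "norm (u b - u a - (b - a) *\<^sub>R g t) \<le> e * (b - a)"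
        if ab: "a < b" "a \<le> t" "t \<le> b" "b - a < d" "0 \<le> a" "b \<le> S" for a b
      proof -
        have "norm (u b - u a - (b - a) *\<^sub>R g t) \<le> norm (u b - u a - (b - a) *\<^sub>R z) + norm ((b - a) *\<^sub>R (z - g t))"
          using norm_triangle_ineq[of "u b - u a - (b - a) *\<^sub>R z" "(b - a) *\<^sub>R (z - g t)"]
          by (simp add: scaleR_diff_right)
        also have "norm (u b - u a - (b - a) *\<^sub>R z) \<le> (f z t + e/3) * (b - a)"
          using bound[of a b z] d(2)[OF ab(1-4)] ab by simp
        also have "\<dots> \<le> (e/3 + e/3) * (b - a)" using fz ab by (intro mult_right_mono) auto
        also have "norm ((b - a) *\<^sub>R (z - g t)) \<le> e/3 * (b - a)"
          using z(2) ab by (simp add: dist_norm mult.commute)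
        finally show ?thesis by (simp add: field_simps)
      qed
      show "\<exists>d>0. \<forall>y. norm (y - t) < d \<longrightarrow> norm (u y - u t - (y - t) *\<^sub>R g t) \<le> e * norm (y - t)"
      proof (intro exI[of _ "min d (min t (S - t))"] conjI allI impI)
        show "0 < min d (min t (S - t))" using d t by simp
        fix y assume y: "norm (y - t) < min d (min t (S - t))"
        consider "y = t" | "t < y" | "y < t" by linarith
        then show "norm (u y - u t - (y - t) *\<^sub>R g t) \<le> e * norm (y - t)"
        proof cases
          case 2 then show ?thesis using key[of t y] y t by simp
        next
          case 3
          have "norm (u y - u t - (y - t) *\<^sub>R g t) = norm (u t - u y - (t - y) *\<^sub>R g t)"
            by (subst norm_minus_cancel[symmetric]) (simp add: algebra_simps)
          then show ?thesis using 3 key[of y t] y t by simp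
        qed simp
      qed
    qed
  qed
qed

section \<open>Limits of step measures\<close>

text \<open>Serves for two exchanges of limits: countable unions are approximated by finite ones,
  and arbitrary times by rational ones. The sequence \<open>Y\<close> may change with
  \<open>e\<close>.\<close>

lemma convergent_if_approximable:
  fixes X :: "nat \<Rightarrow> 'b::banach"
  assumes "\<And>e. 0 < e \<Longrightarrow> \<exists>Y. convergent Y \<and> eventually (\<lambda>n. norm (X n - Y n) \<le> e) sequentially"
  shows "convergent X"
proof -
  have "Cauchy X"
  proof (rule CauchyI)
    fix e :: real assume e: "0 < e"
    then obtain Y where Y: "convergent Y" "eventually (\<lambda>n. norm (X n - Y n) \<le> e/4) sequentially"
      using assms[of "e/4"] by auto
    from Y(1) have "Cauchy Y" by (rule convergent_Cauchy)
    then obtain N1 where N1: "\<And>m n. N1 \<le> m \<Longrightarrow> N1 \<le> n \<Longrightarrow> norm (Y m - Y n) < e/4"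
      using CauchyD[of Y "e/4"] e by auto
    from Y(2) obtain N2 where N2: "\<And>n. N2 \<le> n \<Longrightarrow> norm (X n - Y n) \<le> e/4"
      by (auto simp: eventually_sequentially)
    have "norm (X m - X n) < e" if "max N1 N2 \<le> m" "max N1 N2 \<le> n" for m n
    proof -
      have "norm (X m - X n) \<le> norm (X m - Y m) + norm (Y m - Y n) + norm (X n - Y n)"
        using norm_triangle_ineq4[of "(X m - Y m) + (Y m - Y n)" "X n - Y n"]
          norm_triangle_ineq[of "X m - Y m" "Y m - Y n"] by simp
      then show ?thesis using N1[of m n] N2[of m] N2[of n] that e by simp
    qed
    then show "\<exists>N. \<forall>m\<ge>N. \<forall>n\<ge>N. norm (X m - X n) < e" by blast
  qed
  then show ?thesis by (rule Cauchy_convergent)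
qed

lemma UN_nat_split:
  fixes A :: "nat \<Rightarrow> 'a set"
  shows "(\<Union>i. A i) = (\<Union>i<N. A i) \<union> (\<Union>i\<in>{N..}. A i)"
proof -
  have "(UNIV :: nat set) = {..<N} \<union> {N..}" by auto
  then show ?thesis by (metis UN_Un)
qed

lemma disjoint_family_UN_disjoint:
  assumes "disjoint_family A" "J \<inter> K = {}"
  shows "(\<Union>i\<in>J. A i) \<inter> (\<Union>i\<in>K. A i) = {}"
  using assms unfolding disjoint_family_on_def by (simp add: disjoint_iff) metis

text \<open>For disjoint \<open>I k\<close> this is the integral over \<open>A\<close> of the step
  function with value \<open>w k\<close> on \<open>I k\<close>; as a finite sum it is defined
  without any integration theory in the dual.\<close>

definition step_measure ::
    "'a measure \<Rightarrow> nat \<Rightarrow> (nat \<Rightarrow> 'a set) \<Rightarrow> (nat \<Rightarrow> 'b::real_normed_vector) \<Rightarrow> 'a set \<Rightarrow> 'b" where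
  "step_measure M m I w A = (\<Sum>k<m. measure M (A \<inter> I k) *\<^sub>R w k)"

context finite_measure
begin

text \<open>Cauchy-Schwarz for the step function against the indicator of \<open>A\<close>. The
  bound sees the step function only through its L2 norm, so it is uniform along a sequence with
  bounded energy.\<close>

lemma step_variation_le:
  fixes w :: "nat \<Rightarrow> 'b::real_normed_vector"
  assumes A: "A \<in> sets M" and I: "\<And>k. I k \<in> sets M" "disjoint_family_on I {..<m}"
    and C: "0 \<le> C" "(\<Sum>k<m. measure M (I k) * (norm (w k))\<^sup>2) \<le> C\<^sup>2"
  shows "(\<Sum>k<m. measure M (A \<inter> I k) * norm (w k)) \<le> C * sqrt (measure M A)"
proof -
  let ?a = "\<lambda>k. sqrt (measure M (A \<inter> I k))"
  have "(\<Sum>k<m. measure M (A \<inter> I k) * norm (w k)) = (\<Sum>k<m. \<bar>?a k\<bar> * \<bar>?a k * norm (w k)\<bar>)"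
    by (simp add: abs_mult mult.assoc[symmetric])
  also have "\<dots> \<le> L2_set ?a {..<m} * L2_set (\<lambda>k. ?a k * norm (w k)) {..<m}"
    by (rule L2_set_mult_ineq)
  also have "L2_set ?a {..<m} \<le> sqrt (measure M A)"
  proof -
    have "(\<Sum>k<m. measure M (A \<inter> I k)) = measure M (\<Union>k<m. A \<inter> I k)"
      using A I by (intro finite_measure_finite_Union[symmetric]) (auto simp: disjoint_family_on_def)
    also have "\<dots> \<le> measure M A" using A I by (intro finite_measure_mono) auto
    finally show ?thesis by (simp add: L2_set_def)
  qed
  also have "L2_set (\<lambda>k. ?a k * norm (w k)) {..<m} \<le> C"
  proof -
    have "(\<Sum>k<m. (?a k * norm (w k))\<^sup>2) \<le> (\<Sum>k<m. measure M (I k) * (norm (w k))\<^sup>2)"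
      using A I by (intro sum_mono) (auto simp: power_mult_distrib intro!: mult_right_mono finite_measure_mono)
    also have "\<dots> \<le> C\<^sup>2" by fact
    finally show ?thesis using C(1) by (simp add: L2_set_def real_le_lsqrt sum_nonneg)
  qed
  finally show ?thesis by (simp add: L2_set_nonneg mult.commute mult_left_mono mult_right_mono)
qed

lemma norm_step_measure_le:
  fixes w :: "nat \<Rightarrow> 'b::real_normed_vector"
  shows "norm (step_measure M m I w A) \<le> (\<Sum>k<m. measure M (A \<inter> I k) * norm (w k))"
  unfolding step_measure_def by (rule order_trans[OF norm_sum]) simp

lemma step_measure_Un:
  assumes "A \<in> sets M" "B \<in> sets M" "A \<inter> B = {}" "\<And>k. I k \<in> sets M"
  shows "step_measure M m I w (A \<union> B) = step_measure M m I w A + step_measure M m I w B"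
proof -
  have "measure M ((A \<union> B) \<inter> I k) = measure M (A \<inter> I k) + measure M (B \<inter> I k)" for k
    unfolding Int_Un_distrib2
    by (intro finite_measure_Union sets.Int assms) (use assms(3) in blast)
  then show ?thesis by (simp add: step_measure_def scaleR_add_left sum.distrib)
qed

lemma tendsto_measure_tail:
  assumes "range A \<subseteq> sets M" "disjoint_family A"
  shows "(\<lambda>N. measure M (\<Union>i\<in>{N..}. A i)) \<longlonglongrightarrow> 0"
proof -
  have A: "A i \<in> sets M" for i using assms by auto
  have "measure M (\<Union>i\<in>{N..}. A i) = measure M (\<Union>i. A i) - (\<Sum>i<N. measure M (A i))" for N
  proof -
    have "(\<Sum>i<N. measure M (A i)) = measure M (\<Union>i<N. A i)"
      using A assms(2) by (intro finite_measure_finite_Union[symmetric]) (auto simp: disjoint_family_on_def)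
    moreover have "(\<Union>i. A i) = (\<Union>i<N. A i) \<union> (\<Union>i\<in>{N..}. A i)"
      by (rule UN_nat_split)
    moreover have "measure M ((\<Union>i<N. A i) \<union> (\<Union>i\<in>{N..}. A i)) = measure M (\<Union>i<N. A i) + measure M (\<Union>i\<in>{N..}. A i)"
    proof (rule finite_measure_Union)
      show "(\<Union>i<N. A i) \<inter> (\<Union>i\<in>{N..}. A i) = {}"
        by (rule disjoint_family_UN_disjoint) (use assms(2) in auto)
    qed (use A in auto)
    ultimately show ?thesis by simp
  qed
  moreover have "(\<lambda>N. measure M (\<Union>i. A i) - (\<Sum>i<N. measure M (A i))) \<longlonglongrightarrow> measure M (\<Union>i. A i) - measure M (\<Union>i. A i)"
    using finite_measure_UNION[OF assms] by (intro tendsto_diff tendsto_const) (simp add: sums_def)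
  ultimately show ?thesis by simp
qed

text \<open>Induction over the Dynkin system generated by \<open>G\<close>. Countable unions are
  where the energy bound enters: the tail of the union has small measure, hence contributes little
  for all \<open>n\<close> simultaneously, and the finite part converges by induction.\<close>

lemma convergent_step_measures:
  fixes w :: "nat \<Rightarrow> nat \<Rightarrow> 'b::banach"
  assumes I: "\<And>n k. I n k \<in> sets M" "\<And>n. disjoint_family_on (I n) {..<m n}"
    and C: "0 \<le> C" "\<And>n. (\<Sum>k<m n. measure M (I n k) * (norm (w n k))\<^sup>2) \<le> C\<^sup>2"
    and G: "sets M = sigma_sets (space M) G" "Int_stable G" "G \<subseteq> Pow (space M)"
    and cG: "\<And>A. A \<in> G \<Longrightarrow> convergent (\<lambda>n. step_measure M (m n) (I n) (w n) A)"
    and cspace: "convergent (\<lambda>n. step_measure M (m n) (I n) (w n) (space M))"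
    and A: "A \<in> sets M"
  shows "convergent (\<lambda>n. step_measure M (m n) (I n) (w n) A)"
  using G(2,3) A[unfolded G(1)]
proof (induction rule: sigma_sets_induct_disjoint)
  case (basic A)
  then show ?case by (rule cG)
next
  case empty
  then show ?case by (simp add: step_measure_def convergent_const)
next
  case (compl A)
  then have A: "A \<in> sets M" by (simp add: G(1))
  have "step_measure M (m n) (I n) (w n) (space M - A)
      = step_measure M (m n) (I n) (w n) (space M) - step_measure M (m n) (I n) (w n) A" for n
  proof -
    have "(space M - A) \<union> A = space M" using sets.sets_into_space[OF A] by auto
    moreover have "(space M - A) \<inter> A = {}" by blast
    ultimately show ?thesis
      using step_measure_Un[of "space M - A" A "I n" "m n" "w n"] A I(1) by (simp add: algebra_simps)
  qed
  then show ?case using convergent_diff[OF cspace compl.IH] by simp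
next
  case (union A)
  have A: "range A \<subseteq> sets M" using union by (simp add: G(1))
  show ?case
  proof (rule convergent_if_approximable)
    fix e :: real assume e: "0 < e"
    have "(\<lambda>N. C * sqrt (measure M (\<Union>i\<in>{N..}. A i))) \<longlonglongrightarrow> C * sqrt 0"
      using tendsto_measure_tail[OF A union(1)] by (intro tendsto_intros)
    then have "eventually (\<lambda>N. C * sqrt (measure M (\<Union>i\<in>{N..}. A i)) < e) sequentially"
      using e by (intro order_tendstoD(2)) auto
    then obtain N where N: "C * sqrt (measure M (\<Union>i\<in>{N..}. A i)) < e"
      by (auto simp: eventually_sequentially)
    have sum: "step_measure M (m n) (I n) (w n) (\<Union>i<K. A i) = (\<Sum>i<K. step_measure M (m n) (I n) (w n) (A i))" for n K
    proof (induction K)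
      case 0
      show ?case by (simp add: step_measure_def)
    next
      case (Suc K)
      have "(\<Union>i<K. A i) \<inter> A K = {}"
        using disjoint_family_UN_disjoint[of A "{..<K}" "{K}"] union(1) by simp
      then show ?case
        using step_measure_Un[of "\<Union>i<K. A i" "A K" "I n" "m n" "w n"] A I(1) Suc
        by (auto simp: lessThan_Suc Un_commute)
    qed
    have diff: "step_measure M (m n) (I n) (w n) (\<Union>i. A i) - (\<Sum>i<N. step_measure M (m n) (I n) (w n) (A i))
        = step_measure M (m n) (I n) (w n) (\<Union>i\<in>{N..}. A i)" for n
    proof -
      have "(\<Union>i. A i) = (\<Union>i<N. A i) \<union> (\<Union>i\<in>{N..}. A i)"
        by (rule UN_nat_split)
      moreover have "(\<Union>i<N. A i) \<inter> (\<Union>i\<in>{N..}. A i) = {}"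
        by (rule disjoint_family_UN_disjoint) (use union(1) in auto)
      ultimately show ?thesis
        using step_measure_Un[of "\<Union>i<N. A i" "\<Union>i\<in>{N..}. A i" "I n" "m n" "w n"] A I(1)
        by (auto simp: sum)
    qed
    show "\<exists>Y. convergent Y \<and> eventually (\<lambda>n. norm (step_measure M (m n) (I n) (w n) (\<Union>i. A i) - Y n) \<le> e) sequentially"
    proof (intro exI[of _ "\<lambda>n. \<Sum>i<N. step_measure M (m n) (I n) (w n) (A i)"] conjI always_eventually allI)
      show "convergent (\<lambda>n. \<Sum>i<N. step_measure M (m n) (I n) (w n) (A i))"
        using union by (intro convergent_sum) auto
      fix n
      have "norm (step_measure M (m n) (I n) (w n) (\<Union>i\<in>{N..}. A i)) \<le> C * sqrt (measure M (\<Union>i\<in>{N..}. A i))"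
        using A by (intro order_trans[OF norm_step_measure_le step_variation_le] I C) auto
      then show "norm (step_measure M (m n) (I n) (w n) (\<Union>i. A i) - (\<Sum>i<N. step_measure M (m n) (I n) (w n) (A i))) \<le> e"
        using N by (simp add: diff)
    qed
  qed
qed

text \<open>The bound \<open>C * sqrt (measure M A)\<close> survives the limit; it yields countable
  additivity, because tails of disjoint unions have measure tending to 0, and vanishing on null
  sets.\<close>

lemma vector_measure_limit_of_step_measures:
  fixes w :: "nat \<Rightarrow> nat \<Rightarrow> 'b::banach"
  assumes I: "\<And>n k. I n k \<in> sets M" "\<And>n. disjoint_family_on (I n) {..<m n}"
    and C: "0 \<le> C" "\<And>n. (\<Sum>k<m n. measure M (I n k) * (norm (w n k))\<^sup>2) \<le> C\<^sup>2"
    and lim: "\<And>A. A \<in> sets M \<Longrightarrow> (\<lambda>n. step_measure M (m n) (I n) (w n) A) \<longlonglongrightarrow> F A"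
  shows "vector_measure M F" "finite_variation M F" "\<forall>A\<in>null_sets M. F A = 0"
proof -
  have norm_F: "norm (F A) \<le> C * sqrt (measure M A)" if A: "A \<in> sets M" for A
  proof (rule tendsto_upperbound[OF tendsto_norm[OF lim[OF A]]])
    show "eventually (\<lambda>n. norm (step_measure M (m n) (I n) (w n) A) \<le> C * sqrt (measure M A)) sequentially"
      using A by (intro always_eventually allI order_trans[OF norm_step_measure_le step_variation_le] I C) auto
  qed simp
  have F_Un: "F (A \<union> B) = F A + F B" if "A \<in> sets M" "B \<in> sets M" "A \<inter> B = {}" for A B
  proof (rule LIMSEQ_unique)
    show "(\<lambda>n. step_measure M (m n) (I n) (w n) (A \<union> B)) \<longlonglongrightarrow> F (A \<union> B)"
      using that by (intro lim) auto
    show "(\<lambda>n. step_measure M (m n) (I n) (w n) (A \<union> B)) \<longlonglongrightarrow> F A + F B"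
      using tendsto_add[OF lim lim, of A B] that I(1) by (simp add: step_measure_Un)
  qed
  show "\<forall>A\<in>null_sets M. F A = 0"
    using norm_F by (auto simp: null_sets_def measure_def dest!: norm_F)
  show "finite_variation M F"
    unfolding finite_variation_def
  \<comment> \<open>Summing the bound on single sets is useless here, since the square root is not
    additive. The sum over \<open>P\<close> is therefore taken before the limit, inside the step
    measures, and Cauchy-Schwarz is applied once to the whole space.\<close>
  proof (intro exI[of _ "C * sqrt (measure M (space M))"] allI impI)
    fix P assume P: "finite P \<and> P \<subseteq> sets M \<and> disjoint P"
    have "(\<lambda>n. \<Sum>A\<in>P. norm (step_measure M (m n) (I n) (w n) A)) \<longlonglongrightarrow> (\<Sum>A\<in>P. norm (F A))"
      using P by (intro tendsto_sum tendsto_norm lim) auto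
    then show "(\<Sum>A\<in>P. norm (F A)) \<le> C * sqrt (measure M (space M))"
    proof (rule tendsto_upperbound[OF _ always_eventually[OF allI]])
      fix n
      have "(\<Sum>A\<in>P. norm (step_measure M (m n) (I n) (w n) A)) \<le> (\<Sum>A\<in>P. \<Sum>k<m n. measure M (A \<inter> I n k) * norm (w n k))"
        by (intro sum_mono norm_step_measure_le)
      also have "\<dots> = (\<Sum>k<m n. (\<Sum>A\<in>P. measure M (A \<inter> I n k)) * norm (w n k))"
        by (subst sum.swap) (simp add: sum_distrib_right)
      also have "\<dots> \<le> (\<Sum>k<m n. measure M (space M \<inter> I n k) * norm (w n k))"
      proof (intro sum_mono mult_right_mono)
        fix k
        have "(\<Sum>A\<in>P. measure M (A \<inter> I n k)) = measure M (\<Union>A\<in>P. A \<inter> I n k)"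
        proof (rule finite_measure_finite_Union[symmetric])
          show "disjoint_family_on (\<lambda>A. A \<inter> I n k) P"
            using P unfolding disjoint_family_on_def disjoint_def by blast
        qed (use P I(1) in auto)
        also have "\<dots> \<le> measure M (space M \<inter> I n k)"
          using P I(1) sets.sets_into_space by (intro finite_measure_mono) blast+
        finally show "(\<Sum>A\<in>P. measure M (A \<inter> I n k)) \<le> measure M (space M \<inter> I n k)" .
      qed simp
      also have "\<dots> \<le> C * sqrt (measure M (space M))"
        by (intro step_variation_le I C) auto
      finally show "(\<Sum>A\<in>P. norm (step_measure M (m n) (I n) (w n) A)) \<le> C * sqrt (measure M (space M))" .
    qed simp
  qed
  show "vector_measure M F"
    unfolding vector_measure_def
  proof (intro allI impI)
    fix A :: "nat \<Rightarrow> 'a set" assume "range A \<subseteq> sets M \<and> disjoint_family A"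
    then have A: "range A \<subseteq> sets M" "disjoint_family A" by auto
    have F0: "F {} = 0" using norm_F[of "{}"] by simp
    have sum: "F (\<Union>i<K. A i) = (\<Sum>i<K. F (A i))" for K
    proof (induction K)
      case (Suc K)
      have "(\<Union>i<K. A i) \<inter> A K = {}"
        using disjoint_family_UN_disjoint[of A "{..<K}" "{K}"] A(2) by simp
      then show ?case
        using F_Un[of "\<Union>i<K. A i" "A K"] A Suc by (auto simp: lessThan_Suc Un_commute)
    qed (simp add: F0)
    have diff: "F (\<Union>i. A i) - (\<Sum>i<N. F (A i)) = F (\<Union>i\<in>{N..}. A i)" for N
    proof -
      have "(\<Union>i. A i) = (\<Union>i<N. A i) \<union> (\<Union>i\<in>{N..}. A i)"
        by (rule UN_nat_split)
      moreover have "(\<Union>i<N. A i) \<inter> (\<Union>i\<in>{N..}. A i) = {}"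
        by (rule disjoint_family_UN_disjoint) (use A(2) in auto)
      ultimately show ?thesis
        using F_Un[of "\<Union>i<N. A i" "\<Union>i\<in>{N..}. A i"] A by (auto simp: sum)
    qed
    have "(\<lambda>N. C * sqrt (measure M (\<Union>i\<in>{N..}. A i))) \<longlonglongrightarrow> C * sqrt 0"
      using tendsto_measure_tail[OF A] by (intro tendsto_intros)
    then have "(\<lambda>N. C * sqrt (measure M (\<Union>i\<in>{N..}. A i))) \<longlonglongrightarrow> 0" by simp
    then have "(\<lambda>N. F (\<Union>i. A i) - (\<Sum>i<N. F (A i))) \<longlonglongrightarrow> 0"
    proof (rule Lim_null_comparison[rotated])
      show "eventually (\<lambda>N. norm (F (\<Union>i. A i) - (\<Sum>i<N. F (A i))) \<le> C * sqrt (measure M (\<Union>i\<in>{N..}. A i))) sequentially"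
        using A by (intro always_eventually allI) (auto simp: diff intro!: norm_F)
    qed
    then have "(\<lambda>N. F (\<Union>i. A i) - (F (\<Union>i. A i) - (\<Sum>i<N. F (A i)))) \<longlonglongrightarrow> F (\<Union>i. A i) - 0"
      by (intro tendsto_diff tendsto_const)
    then show "(\<lambda>n. F (A n)) sums F (\<Union>n. A n)" by (simp add: sums_def)
  qed
qed

end

text \<open>Here \<open>u n k\<close> is the value at time \<open>k / p n\<close>, and the energy
  bound says that the piecewise linear interpolations have derivatives bounded in L2. The measures
  of the derivatives converge, and the Radon-Nikodym property turns the limit measure into a
  derivative of \<open>U\<close>.\<close>

lemma density_of_limit_curve:
  fixes u :: "nat \<Rightarrow> nat \<Rightarrow> 'b::banach" and U :: "real \<Rightarrow> 'b" and p :: "nat \<Rightarrow> nat" and S :: nat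
  assumes rnp: "radon_nikodym_property TYPE('b)"
    and p: "\<And>n. 0 < p n" "filterlim p at_top sequentially"
    and C: "0 \<le> C" "\<And>n. (\<Sum>k<S * p n. real (p n) * (norm (u n (Suc k) - u n k))\<^sup>2) \<le> C\<^sup>2"
    and U: "\<And>t::real. 0 \<le> t \<Longrightarrow> t \<le> S \<Longrightarrow> (\<lambda>n. u n (nat \<lfloor>t * p n\<rfloor>)) \<longlonglongrightarrow> U t"
  obtains g where "g \<in> borel_measurable borel" "set_integrable lborel {0..real S} (\<lambda>x. norm (g x))"
    "\<And>s t::real. 0 \<le> s \<Longrightarrow> s \<le> t \<Longrightarrow> t \<le> S \<Longrightarrow> norm (U t - U s) \<le> (LBINT x:{s..t}. norm (g x))"
    "AE t in lborel. 0 < t \<and> t < S \<longrightarrow> (U has_vector_derivative g t) (at t)"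
proof -
  define M where "M = density lborel (indicator {0..real S})"
  have sM[simp]: "sets M = sets borel" "space M = UNIV" by (auto simp: M_def)
  have emM: "emeasure M A = emeasure lborel (A \<inter> {0..real S})" if "A \<in> sets borel" for A
    using that unfolding M_def
    by (subst emeasure_density)
       (auto simp: nn_integral_indicator[symmetric] simp del: nn_integral_indicator
             intro!: nn_integral_cong split: split_indicator)
  interpret finite_measure M
    by standard (simp add: emM)
  have mM: "measure M A = measure lborel (A \<inter> {0..real S})" if "A \<in> sets borel" for A
    by (simp add: measure_def emM that)
  \<comment> \<open>The cells are half-open so that they are disjoint, and \<open>w n k\<close> is
    the slope on the cell; its factor \<open>p n\<close> turns the mass \<open>1 / p n\<close> of
    the cell back into an increment of \<open>u\<close>.\<close>
  define I where "I = (\<lambda>n k. {real k / p n<..real (Suc k) / p n})"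
  define w where "w = (\<lambda>n k. real (p n) *\<^sub>R (u n (Suc k) - u n k))"
  define m where "m = (\<lambda>n. S * p n)"
  have I_sets: "I n k \<in> sets M" for n k by (simp add: I_def)
  have I_sub: "I n k \<subseteq> {0..real S}" if "k < m n" for n k
  proof -
    have "real (Suc k) \<le> real (S * p n)" using that unfolding m_def by (intro of_nat_mono) simp
    then have "real (Suc k) / p n \<le> S" using p(1)[of n] by (simp add: divide_le_eq)
    moreover have "0 \<le> real k / p n" by simp
    ultimately show ?thesis unfolding I_def
      by (meson atLeastAtMost_iff greaterThanAtMost_iff le_less_trans less_imp_le order_trans subsetI)
  qed
  have I_meas: "measure M (I n k) = 1 / p n" if "k < m n" for n k
  proof -
    have "I n k \<inter> {0..real S} = I n k" using I_sub[OF that] by auto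
    then show ?thesis using p(1)[of n]
      by (simp add: mM[OF I_sets[unfolded sM]]) (simp add: I_def divide_right_mono diff_divide_distrib[symmetric])
  qed
  have I_dj: "disjoint_family_on (I n) J" for n J
  proof -
    have "I n i \<inter> I n j = {}" if "i < j" for i j
    proof -
      have "real (Suc i) \<le> real j" using that by (intro of_nat_mono) simp
      then have "real (Suc i) / p n \<le> real j / p n" by (intro divide_right_mono) auto
      then show ?thesis by (auto simp: I_def)
    qed
    then show ?thesis unfolding disjoint_family_on_def
      by (metis Int_commute linorder_neqE_nat)
  qed
  have energy: "(\<Sum>k<m n. measure M (I n k) * (norm (w n k))\<^sup>2) \<le> C\<^sup>2" for n
  proof -
    have "measure M (I n k) * (norm (w n k))\<^sup>2 = real (p n) * (norm (u n (Suc k) - u n k))\<^sup>2" if "k < m n" for k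
      using p(1)[of n] by (simp add: I_meas[OF that] w_def power_mult_distrib power2_eq_square)
    then have "(\<Sum>k<m n. measure M (I n k) * (norm (w n k))\<^sup>2) = (\<Sum>k<S * p n. real (p n) * (norm (u n (Suc k) - u n k))\<^sup>2)"
      unfolding m_def by (intro sum.cong) (auto simp: m_def)
    then show ?thesis using C(2)[of n] by simp
  qed
  define F where "F = (\<lambda>n. step_measure M (m n) (I n) (w n))"
  have normF: "norm (F n A) \<le> C * sqrt (measure M A)" if "A \<in> sets borel" for n A
    unfolding F_def using that
    by (intro order_trans[OF norm_step_measure_le step_variation_le] I_sets I_dj C energy) auto
  have F_Un: "F n (A \<union> B) = F n A + F n B" if "A \<in> sets borel" "B \<in> sets borel" "A \<inter> B = {}" for n A B
    unfolding F_def using that by (intro step_measure_Un I_sets) auto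
  have ivl_dj[simp]: "{..a} \<inter> {a<..b} = {}" "{..a} \<inter> {a<..} = {}"
    "{a<..b} \<inter> {c..a} = {}" "{a<..} \<inter> {c..a} = {}" for a b c :: real by auto
  have F_out: "F n A = 0" if "A \<in> sets borel" "A \<inter> {0..real S} = {}" for n A
    using normF[OF that(1), of n] that by (simp add: mM)
  have F_grid: "F n {..real j / p n} = u n j - u n 0" if "j \<le> m n" for n j
  proof -
    have eq: "measure M ({..real j / p n} \<inter> I n k) *\<^sub>R w n k = (if k < j then u n (Suc k) - u n k else 0)"
      if "k < m n" for k
    proof (cases "k < j")
      case True
      then have "real (Suc k) / p n \<le> real j / p n" by (intro divide_right_mono of_nat_mono) auto
      then have "{..real j / p n} \<inter> I n k = I n k" by (auto simp: I_def)
      then show ?thesis using True p(1)[of n] by (simp add: I_meas[OF that] w_def)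
    next
      case False
      then have "real j / p n \<le> real k / p n" by (intro divide_right_mono of_nat_mono) auto
      then have "{..real j / p n} \<inter> I n k = {}" by (auto simp: I_def)
      then show ?thesis using False by simp
    qed
    have "F n {..real j / p n} = (\<Sum>k<m n. if k < j then u n (Suc k) - u n k else 0)"
      unfolding F_def step_measure_def by (intro sum.cong) (auto simp: eq)
    also have "\<dots> = (\<Sum>k\<in>{..<m n} \<inter> {k. k < j}. u n (Suc k) - u n k)"
      by (subst sum.inter_restrict) auto
    also have "{..<m n} \<inter> {k. k < j} = {..<j}" using \<open>j \<le> m n\<close> by auto
    also have "(\<Sum>k<j. u n (Suc k) - u n k) = u n j - u n 0" by (rule sum_lessThan_telescope)
    finally show ?thesis .
  qed
  \<comment> \<open>Up to the last grid point before \<open>t\<close> the sum telescopes. The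
    remaining piece of a cell has mass at most \<open>1 / p n\<close> and contributes at most
    \<open>C * sqrt (1 / p n)\<close>.\<close>
  have lim_atMost: "(\<lambda>n. F n {..t}) \<longlonglongrightarrow> U t - U 0" if t: "0 \<le> t" "t \<le> S" for t :: real
  proof -
    define j where "j = (\<lambda>n. nat \<lfloor>t * p n\<rfloor>)"
    have jle: "real (j n) / p n \<le> t" "t \<le> real (j n) / p n + 1 / p n" for n
    proof -
      have "real (j n) = of_int \<lfloor>t * p n\<rfloor>" using t by (simp add: j_def)
      then have "real (j n) \<le> t * p n" "t * p n \<le> real (j n) + 1" by linarith+
      then show "real (j n) / p n \<le> t" "t \<le> real (j n) / p n + 1 / p n"
        using p(1)[of n] by (auto simp: field_simps)
    qed
    have jm: "j n \<le> m n" for n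
    proof -
      have "real (j n) \<le> t * p n" using jle(1)[of n] p(1)[of n] by (simp add: field_simps)
      also have "\<dots> \<le> real S * real (p n)" using t by (intro mult_right_mono) auto
      finally have "real (j n) \<le> real (m n)" by (simp add: m_def)
      then show ?thesis by simp
    qed
    have split: "F n {..t} = (u n (j n) - u n 0) + F n {real (j n) / p n<..t}" for n
    proof -
      have "{..t} = {..real (j n) / p n} \<union> {real (j n) / p n<..t}" using jle(1)[of n] by auto
      then show ?thesis using F_Un[of "{..real (j n) / p n}" "{real (j n) / p n<..t}" n] F_grid[OF jm, of n] by auto
    qed
    have "(\<lambda>n. F n {real (j n) / p n<..t}) \<longlonglongrightarrow> 0"
    proof (rule Lim_null_comparison)
      show "eventually (\<lambda>n. norm (F n {real (j n) / p n<..t}) \<le> C * sqrt (1 / p n)) sequentially"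
      proof (intro always_eventually allI)
        fix n
        have "0 \<le> real (j n) / p n" by simp
        then have "{real (j n) / p n<..t} \<inter> {0..real S} = {real (j n) / p n<..t}"
          using t by (intro Int_absorb2 subsetI) (simp only: greaterThanAtMost_iff atLeastAtMost_iff, linarith)
        then have "measure M {real (j n) / p n<..t} \<le> 1 / p n"
          using jle[of n] by (simp add: mM)
        then show "norm (F n {real (j n) / p n<..t}) \<le> C * sqrt (1 / p n)"
          by (intro order_trans[OF normF]) (auto intro!: mult_left_mono C)
      qed
      have "(\<lambda>n. 1 / real (p n)) \<longlonglongrightarrow> 0"
        using filterlim_compose[OF lim_1_over_n p(2)] by simp
      then have "(\<lambda>n. C * sqrt (1 / real (p n))) \<longlonglongrightarrow> C * sqrt 0" by (intro tendsto_intros)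
      then show "(\<lambda>n. C * sqrt (1 / real (p n))) \<longlonglongrightarrow> 0" by simp
    qed
    then have "(\<lambda>n. (u n (j n) - u n 0) + F n {real (j n) / p n<..t}) \<longlonglongrightarrow> (U t - U 0) + 0"
      using U[OF t] U[of 0] t by (intro tendsto_add tendsto_diff) (auto simp: j_def)
    then show ?thesis by (simp add: split)
  qed
  \<comment> \<open>The generator contains all half-lines, so times outside \<open>{0..S}\<close>
    must be covered as well; there \<open>M\<close> has no mass.\<close>
  have conv_atMost: "convergent (\<lambda>n. F n {..t})" for t :: real
  proof -
    consider "t < 0" | "0 \<le> t" "t \<le> S" | "t > S" by linarith
    then show ?thesis
    proof cases
      case 1
      then have "F n {..t} = 0" for n by (intro F_out) auto
      then show ?thesis by (simp add: convergent_const)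
    next
      case 2
      then show ?thesis using lim_atMost convergentI by blast
    next
      case 3
      have "F n {..t} = F n {..real S}" for n
        using F_Un[of "{..real S}" "{real S<..t}" n] F_out[of "{real S<..t}" n] 3
        by (simp add: ivl_disj_un_one)
      then show ?thesis using lim_atMost[of S] convergentI by auto
    qed
  qed
  have UNIV_S: "{..real S} \<union> {real S<..} = UNIV" by auto
  have "F n UNIV = F n {..real S}" for n
    using F_Un[of "{..real S}" "{real S<..}" n] F_out[of "{real S<..}" n]
    by (simp add: UNIV_S)
  then have conv_space: "convergent (\<lambda>n. F n (space M))" using conv_atMost by simp
  have gen: "sets M = sigma_sets (space M) (range (atMost :: real \<Rightarrow> _))"
    by (subst sM, subst borel_eq_atMost) simp
  have stable: "Int_stable (range (atMost :: real \<Rightarrow> _))"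
    by (auto simp: Int_stable_def Int_atMost)
  have conv: "convergent (\<lambda>n. F n A)" if "A \<in> sets M" for A
    unfolding F_def
    by (rule convergent_step_measures[OF I_sets I_dj C(1) energy gen stable])
       (use conv_atMost conv_space that in \<open>auto simp: F_def\<close>)
  define G where "G A = lim (\<lambda>n. F n A)" for A
  have lim: "(\<lambda>n. F n A) \<longlonglongrightarrow> G A" if "A \<in> sets M" for A
    unfolding G_def using conv[OF that] by (simp add: convergent_LIMSEQ_iff)
  have "vector_measure M G" "finite_variation M G" "\<forall>A\<in>null_sets M. G A = 0"
    using vector_measure_limit_of_step_measures[OF I_sets I_dj C(1) energy lim[unfolded F_def]] by auto
  then obtain g where g: "\<And>A. A \<in> sets M \<Longrightarrow> has_bochner_int M (\<lambda>x. indicator A x *\<^sub>R g x) (G A)"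
    using rnp finite_measure_axioms unfolding radon_nikodym_property_def by blast
  have GU: "G {s<..t} = U t - U s" if st: "0 \<le> s" "s \<le> t" "t \<le> S" for s t :: real
  proof (rule LIMSEQ_unique)
    show "(\<lambda>n. F n {s<..t}) \<longlonglongrightarrow> G {s<..t}" by (intro lim) simp
    have "F n {s<..t} = F n {..t} - F n {..s}" for n
      using F_Un[of "{..s}" "{s<..t}" n] st by (auto simp: ivl_disj_un_one)
    moreover have "(\<lambda>n. F n {..t} - F n {..s}) \<longlonglongrightarrow> (U t - U 0) - (U s - U 0)"
      using st by (intro tendsto_diff lim_atMost) auto
    ultimately show "(\<lambda>n. F n {s<..t}) \<longlonglongrightarrow> U t - U s" by simp
  qed
  show ?thesis
    using has_vector_derivative_if_density[OF M_def g GU] by (intro that) auto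
qed

section \<open>Minimizing movements\<close>

lemma gradient_has_derivative:
  fixes f :: "'v::real_normed_vector \<Rightarrow> real"
  assumes "f differentiable (at x)"
  shows "(f has_derivative blinfun_apply (gradient f x)) (at x)"
proof -
  have "(f has_derivative frechet_derivative f (at x)) (at x)"
    using assms by (simp add: frechet_derivative_works)
  then show ?thesis
    by (simp add: gradient_def bounded_linear_Blinfun_apply has_derivative_bounded_linear)
qed

lemma bregman_three_point:
  "bregman f y x' - bregman f y x + bregman f x' x
    = blinfun_apply (gradient f x' - gradient f x) (x' - y)"
  by (simp add: bregman_def blinfun.diff_left blinfun.diff_right)

lemma bregman_symm: 
  "bregman f y x + bregman f x y = blinfun_apply (gradient f y - gradient f x) (y - x)"
  by (simp add: bregman_def blinfun.diff_left blinfun.diff_right)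

lemma powr_le_imp_le_powr_inverse:
  fixes a b c :: real
  assumes "0 < c" "0 \<le> a" "a powr c \<le> b"
  shows "a \<le> b powr (1 / c)"
proof -
  have "a = (a powr c) powr (1 / c)" using assms by (simp add: powr_powr)
  also have "\<dots> \<le> b powr (1 / c)" using assms by (intro powr_mono2) auto
  finally show ?thesis .
qed

text \<open>Divergence at 0 gives the bound 1 on some interval \<open>(0, d)\<close>, and on the
  compact rest \<open>{d..U}\<close> the continuous positive function attains its minimum.\<close>

lemma positive_lower_bound_near_0:
  fixes g :: "real \<Rightarrow> real"
  assumes "continuous_on {0<..} g" "\<And>r. 0 < r \<Longrightarrow> 0 < g r" "filterlim g at_top (at_right 0)"
  obtains c where "0 < c" "\<And>r. 0 < r \<Longrightarrow> r \<le> U \<Longrightarrow> c \<le> g r"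
proof -
  have "eventually (\<lambda>r. 1 \<le> g r) (at_right 0)" using assms(3) by (simp add: filterlim_at_top)
  then obtain d where d: "0 < d" "\<And>r. 0 < r \<Longrightarrow> r < d \<Longrightarrow> 1 \<le> g r"
    by (auto simp: eventually_at_right_field)
  show ?thesis
  proof (cases "d \<le> U")
    case False
    then show ?thesis using d by (intro that[of 1]) auto
  next
    case True
    have "continuous_on {d..U} g" by (rule continuous_on_subset[OF assms(1)]) (use d in auto)
    then obtain r0 where r0: "r0 \<in> {d..U}" "\<And>r. r \<in> {d..U} \<Longrightarrow> g r0 \<le> g r"
      using continuous_attains_inf[of "{d..U}" g] True by auto
    show ?thesis
    proof (rule that[of "min 1 (g r0)"])
      show "0 < min 1 (g r0)" using assms(2)[of r0] r0 d by auto
      show "min 1 (g r0) \<le> g r" if "0 < r" "r \<le> U" for r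
        using d(2)[of r] r0(2)[of r] that by (cases "r < d") auto
    qed
  qed
qed

locale mirror_setting =
  fixes \<Psi> :: "'a::banach \<Rightarrow> real"
    and \<Psi>s :: "('a \<Rightarrow>\<^sub>L real) \<Rightarrow> real"
    and \<Phi> :: "'a \<Rightarrow> ereal"
    and lam \<alpha> C\<^sub>\<alpha> \<beta> C\<^sub>\<beta> m\<^sub>\<beta> :: real
    and g :: "real \<Rightarrow> real"
  assumes Psi_C1: "C1_functional \<Psi>"
    and Psis_conjugate: "\<forall>\<phi>. convex_conjugate \<Psi> \<phi> = ereal (\<Psi>s \<phi>)"
    and Psis_C1: "C1_functional \<Psi>s"
    and Phi_not_MInf: "\<forall>x. \<Phi> x \<noteq> -\<infinity>"
    and Phi_lambda_convex: "lambda_convex_for lam \<Psi> \<Phi>"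
    and alpha: "1 < \<alpha>" "0 < C\<^sub>\<alpha>"
    and Psi_unif_convex: "\<forall>x y. norm (y - x) powr \<alpha> \<le> C\<^sub>\<alpha> * bregman \<Psi> y x"
    and g_cont: "continuous_on {0<..} g"
    and g_pos: "\<forall>r>0. 0 < g r"
    and g_at_0: "filterlim g at_top (at_right 0)"
    and Psis_bound:
      "\<forall>\<phi> \<psi>. g (norm \<phi> + norm \<psi>) * (norm (\<phi> - \<psi>))\<^sup>2 \<le> bregman \<Psi>s \<phi> \<psi>"
    and beta: "0 < \<beta>" "0 < C\<^sub>\<beta>" "0 \<le> m\<^sub>\<beta>"
    and grad_growth: "\<forall>x. norm (gradient \<Psi> x) \<le> C\<^sub>\<beta> * norm x powr \<beta> + m\<^sub>\<beta>"
    and Phi_bounded_below: "(INF x. \<Phi> x) > -\<infinity>"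
    and Phi_compact: "\<forall>r>0. \<forall>c::real. compact {x. norm x \<le> r \<and> \<Phi> x \<le> ereal c}"
begin

abbreviation "D \<equiv> bregman \<Psi>"
abbreviation "grad \<equiv> gradient \<Psi>"
abbreviation "fin y \<equiv> \<Phi> y < \<infinity>"
text \<open>Has the default value 0 where \<Phi> is infinite; its use as the value of \<Phi> is
  therefore always accompanied by \<open>fin\<close>.\<close>

definition "f y = real_of_ereal (\<Phi> y)"

lemma Phi_eq: "fin y \<Longrightarrow> \<Phi> y = ereal (f y)"
  using Phi_not_MInf by (cases "\<Phi> y") (auto simp: f_def)

lemma Psi_derivative: "(\<Psi> has_derivative blinfun_apply (grad x)) (at x)"
  using Psi_C1 by (intro gradient_has_derivative) (simp add: C1_functional_def)

lemma Psi_continuous: "continuous_on UNIV \<Psi>"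
  using Psi_derivative has_derivative_continuous by (intro continuous_at_imp_continuous_on) blast

lemma gradient_continuous: "continuous_on UNIV grad"
  using Psi_C1 by (simp add: C1_functional_def)

lemma tendsto_Psi: "(X \<longlongrightarrow> x) F \<Longrightarrow> ((\<lambda>n. \<Psi> (X n)) \<longlongrightarrow> \<Psi> x) F"
  using Psi_continuous continuous_on_tendsto_compose by fastforce

lemma tendsto_gradient: "(X \<longlongrightarrow> x) F \<Longrightarrow> ((\<lambda>n. grad (X n)) \<longlongrightarrow> grad x) F"
  using gradient_continuous continuous_on_tendsto_compose by fastforce

lemma D_nonneg: "0 \<le> D y x"
proof -
  have "0 \<le> C\<^sub>\<alpha> * D y x" using Psi_unif_convex powr_ge_zero order_trans by blast
  then show ?thesis using alpha by (simp add: zero_le_mult_iff)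
qed

lemma D_self [simp]: "D x x = 0"
  by (simp add: bregman_def)

section \<open>Duality between \<Psi> and its conjugate\<close>

lemma Psis_ge: "blinfun_apply \<phi> x - \<Psi> x \<le> \<Psi>s \<phi>"
proof -
  have "ereal (blinfun_apply \<phi> x - \<Psi> x) \<le> convex_conjugate \<Psi> \<phi>"
    unfolding convex_conjugate_def by (rule SUP_upper) simp
  then show ?thesis using Psis_conjugate by simp
qed

text \<open>Equality in Fenchel's inequality: nonnegativity of \<open>D y x\<close> says exactly
  that the supremum defining the conjugate at \<open>grad x\<close> is attained at
  \<open>x\<close>.\<close>

lemma Psis_gradient: "\<Psi>s (grad x) = blinfun_apply (grad x) x - \<Psi> x"
proof (rule antisym[OF _ Psis_ge])
  have "convex_conjugate \<Psi> (grad x) \<le> ereal (blinfun_apply (grad x) x - \<Psi> x)"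
    unfolding convex_conjugate_def
  proof (rule SUP_least)
    fix y show "ereal (blinfun_apply (grad x) y - \<Psi> y) \<le> ereal (blinfun_apply (grad x) x - \<Psi> x)"
      using D_nonneg[of y x] by (simp add: bregman_def blinfun.diff_right)
  qed
  then show "\<Psi>s (grad x) \<le> blinfun_apply (grad x) x - \<Psi> x" using Psis_conjugate by simp
qed

text \<open>By Fenchel's inequality, the conjugate minus evaluation at \<open>x\<close> has a
  minimum at \<open>grad x\<close>, so its derivative vanishes there. The gradient of the conjugate
  is thus evaluation at \<open>x\<close>, as an element of the bidual.\<close>

lemma gradient_Psis_gradient: "blinfun_apply (gradient \<Psi>s (grad x)) \<phi> = blinfun_apply \<phi> x"
proof -
  have "(\<Psi>s has_derivative blinfun_apply (gradient \<Psi>s (grad x))) (at (grad x))"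
    using Psis_C1 by (intro gradient_has_derivative) (simp add: C1_functional_def)
  moreover have "((\<lambda>\<phi>. blinfun_apply \<phi> x) has_derivative (\<lambda>\<phi>. blinfun_apply \<phi> x)) (at (grad x))"
    by (intro bounded_linear_imp_has_derivative bounded_linear_intros)
  ultimately have "((\<lambda>\<phi>. \<Psi>s \<phi> - blinfun_apply \<phi> x) has_derivative
      (\<lambda>\<phi>. blinfun_apply (gradient \<Psi>s (grad x)) \<phi> - blinfun_apply \<phi> x)) (at (grad x))"
    by (rule has_derivative_diff)
  moreover have "\<Psi>s (grad x) - blinfun_apply (grad x) x \<le> \<Psi>s \<phi> - blinfun_apply \<phi> x" for \<phi>
    using Psis_ge[of \<phi> x] Psis_gradient[of x] by simp
  ultimately have "(\<lambda>\<phi>. blinfun_apply (gradient \<Psi>s (grad x)) \<phi> - blinfun_apply \<phi> x) = (\<lambda>v. 0)"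
    by (intro differential_zero_maxmin[of "grad x" UNIV]) auto
  then show ?thesis by (metis eq_iff_diff_eq_0)
qed

text \<open>Passing to the dual exchanges the two arguments. The identity converts the bound assumed
  for the conjugate into a lower bound for \<open>D\<close> in terms of gradients.\<close>

lemma bregman_conjugate: "bregman \<Psi>s (grad y) (grad x) = D x y"
  by (simp add: bregman_def Psis_gradient gradient_Psis_gradient blinfun.diff_left blinfun.diff_right)

text \<open>The symmetrized divergence is the pairing of the gradient difference with
  \<open>y - x\<close>; coercivity bounds it from below by a multiple of
  \<open>norm (y - x) powr \<alpha>\<close>, and one factor \<open>norm (y - x)\<close> cancels. The
  gradient map thus has a Hoelder continuous inverse on its range.\<close>

lemma norm_diff_le_gradient_diff:
  "norm (y - x) \<le> (C\<^sub>\<alpha> * norm (grad y - grad x)) powr (1 / (\<alpha> - 1))"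
proof (cases "y = x")
  case False
  then have n: "0 < norm (y - x)" by simp
  have "norm (y - x) powr \<alpha> \<le> C\<^sub>\<alpha> * (D y x + D x y)"
    using Psi_unif_convex[rule_format, of y x] D_nonneg[of x y] alpha
    by (simp add: distrib_left add_increasing2)
  also have "D y x + D x y \<le> norm (grad y - grad x) * norm (y - x)"
    unfolding bregman_symm using norm_blinfun[of "grad y - grad x" "y - x"] by simp
  finally have "norm (y - x) powr \<alpha> \<le> (C\<^sub>\<alpha> * norm (grad y - grad x)) * norm (y - x)"
    using alpha by (simp add: mult.assoc)
  moreover have "norm (y - x) powr \<alpha> = norm (y - x) powr (\<alpha> - 1) * norm (y - x)"
    using n by (simp add: powr_diff)
  ultimately have "norm (y - x) powr (\<alpha> - 1) \<le> C\<^sub>\<alpha> * norm (grad y - grad x)" using n by simp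
  then show ?thesis using alpha by (intro powr_le_imp_le_powr_inverse) auto
qed simp

text \<open>Compact pieces of sublevel sets are closed, so their complements are open. The radius
  \<open>norm x + 1\<close> ensures that points within distance 1 can leave the piece only through
  the value of \<Phi>.\<close>

lemma Phi_lower_nbhd:
  assumes "ereal c < \<Phi> x"
  obtains d where "0 < d" "\<And>y. dist y x < d \<Longrightarrow> ereal c < \<Phi> y"
proof -
  let ?K = "{y. norm y \<le> norm x + 1 \<and> \<Phi> y \<le> ereal c}"
  have "compact ?K" using Phi_compact[rule_format, of "norm x + 1" c]
    by (simp add: add_nonneg_pos)
  then have "open (- ?K)" by (simp add: compact_imp_closed open_Compl)
  moreover have "x \<in> - ?K" using assms by simp
  ultimately obtain d where d: "0 < d" "ball x d \<subseteq> - ?K" by (meson open_contains_ball)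
  show ?thesis
  proof (rule that[of "min d 1"])
    fix y assume y: "dist y x < min d 1"
    then have "y \<in> - ?K" using d(2) by (auto simp: dist_commute)
    moreover have "norm y \<le> norm x + 1"
      using y norm_triangle_ineq2[of y x] by (simp add: dist_norm)
    ultimately show "ereal c < \<Phi> y" by simp
  qed (use d in simp)
qed

lemma Phi_limit_le:
  assumes "X \<longlonglongrightarrow> x" "eventually (\<lambda>n. \<Phi> (X n) \<le> ereal c) sequentially"
  shows "\<Phi> x \<le> ereal c"
proof (rule ccontr)
  assume "\<not> \<Phi> x \<le> ereal c"
  then obtain d where d: "0 < d" "\<And>y. dist y x < d \<Longrightarrow> ereal c < \<Phi> y"
    using Phi_lower_nbhd[of c x] by (auto simp: not_le)
  have "eventually (\<lambda>n. dist (X n) x < d) sequentially" using assms(1) d(1) by (rule tendstoD)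
  then have "eventually (\<lambda>n. False) sequentially"
    using assms(2) by eventually_elim (use d(2) in \<open>auto simp: not_le[symmetric]\<close>)
  then show False by simp
qed

section \<open>Existence and optimality of the proximal step\<close>

lemma f_bounded_below:
  obtains b where "\<And>y. fin y \<Longrightarrow> b \<le> f y"
proof -
  have "\<Phi> y \<ge> (INF x. \<Phi> x)" for y by (rule INF_lower) simp
  then have *: "ereal (f y) \<ge> (INF x. \<Phi> x)" if "fin y" for y using Phi_eq[OF that] by metis
  show ?thesis
  proof (cases "INF x. \<Phi> x")
    case (real b)
    then show ?thesis using * that[of b] by simp
  next
    case PInf
    then show ?thesis using * that[of 0] by auto
  next
    case MInf
    then show ?thesis using Phi_bounded_below by simp
  qed
qed

text \<open>Direct method: along a minimizing sequence the lower bound on \<open>f\<close> controls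
  the divergence, coercivity turns this into a norm bound, and the sequence stays in a compact piece
  of a sublevel set.\<close>

lemma proximal_step_exists:
  assumes x: "fin x" and t: "0 < t"
  obtains x' where "fin x'" "\<And>y. fin y \<Longrightarrow> f x' + D x' x / t \<le> f y + D y x / t"
proof -
  obtain b where b: "\<And>y. fin y \<Longrightarrow> b \<le> f y" using f_bounded_below by blast
  define J where "J y = f y + D y x / t" for y
  define m where "m = (INF y\<in>{y. fin y}. J y)"
  have Jb: "b \<le> J y" if "fin y" for y using b[OF that] D_nonneg[of y x] t by (simp add: J_def add_increasing2)
  then have bdd: "bdd_below (J ` {y. fin y})" by (intro bdd_belowI2[of _ b]) auto
  have m_le: "m \<le> J y" if "fin y" for y unfolding m_def using that by (intro cINF_lower bdd) auto
  have "\<exists>y. fin y \<and> J y < m + 1 / Suc n" for n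
  proof -
    have "(INF y\<in>{y. fin y}. J y) < m + 1 / Suc n" unfolding m_def[symmetric] by simp
    then show ?thesis using x by (subst (asm) cINF_less_iff[OF _ bdd]) auto
  qed
  then obtain Y where Y: "\<And>n. fin (Y n)" "\<And>n. J (Y n) < m + 1 / Suc n" by metis
  \<comment> \<open>Since \<open>D x x = 0\<close>, the infimum is at most \<open>f x\<close>; the
    extra 1 absorbs \<open>1 / Suc n\<close>.\<close>
  define c where "c = f x + 1"
  have Jc: "J (Y n) \<le> c" for n
  proof -
    have "1 / real (Suc n) \<le> 1" by simp
    moreover have "m \<le> f x" using m_le[OF x] by (simp add: J_def)
    ultimately show ?thesis using Y(2)[of n] unfolding c_def by linarith
  qed
  define r where "r = norm x + (C\<^sub>\<alpha> * (t * (c - b))) powr (1/\<alpha>) + 1"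
  have YK: "Y n \<in> {y. norm y \<le> r \<and> \<Phi> y \<le> ereal c}" for n
  proof -
    have "f (Y n) \<le> c" using Jc[of n] D_nonneg[of "Y n" x] t
      by (simp add: J_def) (smt (verit) divide_nonneg_pos)
    moreover have "D (Y n) x / t \<le> c - b" using Jc[of n] b[OF Y(1)[of n]] by (simp add: J_def)
    then have "D (Y n) x \<le> t * (c - b)" using t by (simp add: divide_le_eq mult.commute)
    then have "C\<^sub>\<alpha> * D (Y n) x \<le> C\<^sub>\<alpha> * (t * (c - b))" using alpha by simp
    then have "norm (Y n - x) powr \<alpha> \<le> C\<^sub>\<alpha> * (t * (c - b))"
      using Psi_unif_convex[rule_format, of "Y n" x] by linarith
    then have "norm (Y n - x) \<le> (C\<^sub>\<alpha> * (t * (c - b))) powr (1/\<alpha>)"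
      using alpha by (intro powr_le_imp_le_powr_inverse) auto
    then have "norm (Y n) \<le> r" using norm_triangle_ineq2[of "Y n" x] by (simp add: r_def)
    ultimately show ?thesis using Phi_eq[OF Y(1)] by simp
  qed
  have "0 < r" by (simp add: r_def add_nonneg_pos)
  then have "compact {y. norm y \<le> r \<and> \<Phi> y \<le> ereal c}" using Phi_compact by blast
  then obtain y s where ys: "y \<in> {y. norm y \<le> r \<and> \<Phi> y \<le> ereal c}" "strict_mono (s :: nat \<Rightarrow> nat)" "(Y \<circ> s) \<longlonglongrightarrow> y"
    using YK unfolding compact_def by meson
  have fy: "fin y" using ys(1) by (auto intro: le_less_trans)
  have "J y \<le> m"
  \<comment> \<open>Were \<open>J y\<close> larger than \<open>m\<close>, continuity of the
    divergence would push the energies of the sequence eventually below \<open>f y\<close> by half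
    of the gap, against lower semicontinuity at \<open>y\<close>.\<close>
  proof (rule ccontr)
    assume "\<not> J y \<le> m"
    define e where "e = (J y - m) / 2"
    have e: "0 < e" using \<open>\<not> J y \<le> m\<close> by (simp add: e_def)
    have "(\<lambda>n. D (Y (s n)) x) \<longlonglongrightarrow> D y x"
      unfolding bregman_def using ys(3) by (intro tendsto_intros tendsto_Psi) (auto simp: o_def)
    moreover have "(\<lambda>n. 1 / real (Suc (s n))) \<longlonglongrightarrow> 0"
      using LIMSEQ_subseq_LIMSEQ[OF LIMSEQ_inverse_real_of_nat ys(2)] by (simp add: o_def inverse_eq_divide)
    ultimately have "(\<lambda>n. m + 1 / real (Suc (s n)) - D (Y (s n)) x / t) \<longlonglongrightarrow> m + 0 - D y x / t"
      using t by (intro tendsto_intros) auto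
    moreover have "m + 0 - D y x / t < f y - e" using e by (simp add: J_def e_def field_simps)
    ultimately have "eventually (\<lambda>n. m + 1 / real (Suc (s n)) - D (Y (s n)) x / t < f y - e) sequentially"
      by (rule order_tendstoD)
    then have "eventually (\<lambda>n. \<Phi> (Y (s n)) \<le> ereal (f y - e)) sequentially"
    proof eventually_elim
      case (elim n)
      then have "f (Y (s n)) \<le> f y - e" using Y(2)[of "s n"] by (simp add: J_def)
      then show ?case by (simp add: Phi_eq[OF Y(1)])
    qed
    then have "\<Phi> y \<le> ereal (f y - e)" using ys(3) by (intro Phi_limit_le[of "Y \<circ> s"]) (auto simp: o_def)
    then show False using e by (simp add: Phi_eq[OF fy])
  qed
  then show ?thesis using that[OF fy] m_le by (auto simp: J_def intro: order_trans)
qed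

lemma f_lambda_convex:
  assumes "fin x" "fin y" "0 < s" "s < 1"
  shows "fin (x + s *\<^sub>R (y - x))"
    and "f (x + s *\<^sub>R (y - x)) - lam * \<Psi> (x + s *\<^sub>R (y - x))
      \<le> (1 - s) * (f x - lam * \<Psi> x) + s * (f y - lam * \<Psi> y)"
proof -
  let ?z = "x + s *\<^sub>R (y - x)"
  have z: "?z = (1 - s) *\<^sub>R x + s *\<^sub>R y" by (simp add: algebra_simps)
  have "\<Phi> ?z - ereal (lam * \<Psi> ?z) \<le> ereal (1 - s) * (\<Phi> x - ereal (lam * \<Psi> x)) + ereal s * (\<Phi> y - ereal (lam * \<Psi> y))"
    using Phi_lambda_convex assms(3,4) unfolding lambda_convex_for_def ereal_convex_def z by blast
  then have *: "\<Phi> ?z - ereal (lam * \<Psi> ?z) \<le> ereal ((1 - s) * (f x - lam * \<Psi> x) + s * (f y - lam * \<Psi> y))"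
    by (simp add: Phi_eq[OF assms(1)] Phi_eq[OF assms(2)])
  then show fz: "fin ?z" by (cases "\<Phi> ?z") auto
  from * show "f ?z - lam * \<Psi> ?z \<le> (1 - s) * (f x - lam * \<Psi> x) + s * (f y - lam * \<Psi> y)"
    by (simp add: Phi_eq[OF fz])
qed

lemma tendsto_Psi_quotient:
  "((\<lambda>s. (\<Psi> (x + s *\<^sub>R v) - \<Psi> x) / s) \<longlongrightarrow> blinfun_apply (grad x) v) (at_right 0)"
proof -
  have "((\<lambda>s. x + s *\<^sub>R v) has_derivative (\<lambda>s. s *\<^sub>R v)) (at 0)"
    by (auto intro!: derivative_eq_intros)
  moreover have "(\<Psi> has_derivative blinfun_apply (grad x)) (at (x + 0 *\<^sub>R v))"
    using Psi_derivative by simp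
  ultimately have "((\<lambda>s. \<Psi> (x + s *\<^sub>R v)) has_derivative (\<lambda>s. blinfun_apply (grad x) (s *\<^sub>R v))) (at 0)"
    by (rule has_derivative_compose)
  then have "((\<lambda>s. \<Psi> (x + s *\<^sub>R v)) has_real_derivative blinfun_apply (grad x) v) (at 0)"
    by (simp add: has_field_derivative_def blinfun.scaleR_right mult.commute[of _ "blinfun_apply (grad x) v"])
  then have "((\<lambda>s. (\<Psi> (x + s *\<^sub>R v) - \<Psi> x) / s) \<longlongrightarrow> blinfun_apply (grad x) v) (at 0)"
    by (simp add: DERIV_def)
  then show ?thesis by (simp add: filterlim_at_split)
qed

text \<open>The minimizer is compared with points on the segment towards \<open>y\<close>, where
  \<lambda>-convexity bounds the energy, and the comparison is divided by the segment parameter. The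
  derivative of the term \<open>lam * \<Psi>\<close> completes the increment of \<Psi> to the
  divergence \<open>D y x'\<close>.\<close>

lemma proximal_step_variational:
  assumes t: "0 < t" and x': "fin x'" and min: "\<And>y. fin y \<Longrightarrow> f x' + D x' x / t \<le> f y + D y x / t"
    and y: "fin y"
  shows "blinfun_apply (grad x' - grad x) (x' - y) \<le> t * (f y - f x' - lam * D y x')"
proof -
  define v where "v = y - x'"
  define q where "q s = (\<Psi> (x' + s *\<^sub>R v) - \<Psi> x') / s" for s
  define \<Delta> where "\<Delta> = (f y - lam * \<Psi> y) - (f x' - lam * \<Psi> x')"
  have q: "(q \<longlongrightarrow> blinfun_apply (grad x') v) (at_right 0)"
    unfolding q_def by (rule tendsto_Psi_quotient)
  have le: "(blinfun_apply (grad x) v - q s) / t \<le> lam * q s + \<Delta>" if s: "0 < s" "s < 1" for s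
  proof -
    let ?z = "x' + s *\<^sub>R v"
    note c = f_lambda_convex[OF x' y s, folded v_def]
    have "(D x' x - D ?z x) / t \<le> f ?z - f x'" using min[OF c(1)] by (simp add: diff_divide_distrib)
    also have "\<dots> \<le> lam * (\<Psi> ?z - \<Psi> x') + s * \<Delta>" using c(2) by (simp add: \<Delta>_def algebra_simps)
    also have \<Psi>z: "\<Psi> ?z - \<Psi> x' = s * q s" using s by (simp add: q_def)
    \<comment> \<open>Both divergences have the base point \<open>x\<close>, so only \<Psi> and a
      linear term change; this makes the factor \<open>s\<close> explicit and ready for
      cancellation.\<close>
    also have "D x' x - D ?z x = s * (blinfun_apply (grad x) v - q s)"
      unfolding right_diff_distrib \<Psi>z[symmetric]
      by (simp add: bregman_def blinfun.diff_right blinfun.add_right blinfun.scaleR_right)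
    finally have "s * ((blinfun_apply (grad x) v - q s) / t) \<le> s * (lam * q s + \<Delta>)" by (simp add: algebra_simps)
    then show ?thesis using s by (subst (asm) mult_le_cancel_left_pos) auto
  qed
  have "(blinfun_apply (grad x) v - blinfun_apply (grad x') v) / t \<le> lam * blinfun_apply (grad x') v + \<Delta>"
  proof (rule tendsto_le[of "at_right (0::real)"])
    show "((\<lambda>s. (blinfun_apply (grad x) v - q s) / t) \<longlongrightarrow> (blinfun_apply (grad x) v - blinfun_apply (grad x') v) / t) (at_right 0)"
      using t by (intro tendsto_intros q) auto
    show "((\<lambda>s. lam * q s + \<Delta>) \<longlongrightarrow> lam * blinfun_apply (grad x') v + \<Delta>) (at_right 0)"
      by (intro tendsto_intros q)
    show "eventually (\<lambda>s. (blinfun_apply (grad x) v - q s) / t \<le> lam * q s + \<Delta>) (at_right 0)"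
      unfolding eventually_at_right_field using le by (intro exI[of _ 1]) auto
  qed simp
  then have "blinfun_apply (grad x) v - blinfun_apply (grad x') v \<le> t * (lam * blinfun_apply (grad x') v + \<Delta>)"
    using t by (simp add: divide_le_eq mult.commute)
  then show ?thesis
    by (simp add: \<Delta>_def v_def bregman_def blinfun.diff_right blinfun.diff_left algebra_simps)
qed

section \<open>Discrete flows and their a priori bounds\<close>

definition discrete_flow :: "'a \<Rightarrow> real \<Rightarrow> (nat \<Rightarrow> 'a) \<Rightarrow> bool" where
  "discrete_flow x\<^sub>0 t X \<longleftrightarrow> X 0 = x\<^sub>0 \<and> (\<forall>k. fin (X k) \<and>
     f (X (Suc k)) + D (X (Suc k)) (X k) / t \<le> f (X k) \<and>
     (\<forall>y. fin y \<longrightarrow> D y (X (Suc k)) - D y (X k) + D (X (Suc k)) (X k)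
        \<le> t * (f y - f (X (Suc k)) - lam * D y (X (Suc k)))))"

lemma discrete_flow_exists:
  assumes "fin x\<^sub>0" "0 < t"
  obtains X where "discrete_flow x\<^sub>0 t X"
proof -
  let ?Q = "\<lambda>x x'. f x' + D x' x / t \<le> f x \<and> (\<forall>y. fin y \<longrightarrow> D y x' - D y x + D x' x
        \<le> t * (f y - f x' - lam * D y x'))"
  have "\<exists>X. \<forall>k. (fin (X k) \<and> (k = 0 \<longrightarrow> X k = x\<^sub>0)) \<and> ?Q (X k) (X (Suc k))"
  proof (rule dependent_nat_choice)
    show "\<exists>x. fin x \<and> (0 = (0::nat) \<longrightarrow> x = x\<^sub>0)" using assms by blast
    fix x n assume "fin x \<and> (n = (0::nat) \<longrightarrow> x = x\<^sub>0)"
    then have x: "fin x" by simp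
    obtain x' where x': "fin x'" "\<And>y. fin y \<Longrightarrow> f x' + D x' x / t \<le> f y + D y x / t"
      using proximal_step_exists[OF x assms(2)] by blast
    \<comment> \<open>Minimality is used twice and not recorded: the competitor \<open>y = x\<close>
      gives the energy decrease, and the three-point identity rewrites the variational inequality as
      the discrete EVI.\<close>
    have "?Q x x'"
      using x'(2)[OF x] proximal_step_variational[OF assms(2) x'] bregman_three_point[of \<Psi> _ x' x] by simp
    then show "\<exists>x'. (fin x' \<and> (Suc n = 0 \<longrightarrow> x' = x\<^sub>0)) \<and> ?Q x x'" using x' by blast
  qed
  then obtain X where "\<forall>k. (fin (X k) \<and> (k = 0 \<longrightarrow> X k = x\<^sub>0)) \<and> ?Q (X k) (X (Suc k))" ..
  then have "discrete_flow x\<^sub>0 t X" unfolding discrete_flow_def by simp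
  then show ?thesis by (rule that)
qed

lemma discrete_flow_energy:
  assumes X: "discrete_flow x\<^sub>0 t X" and t: "0 < t"
  shows "f (X k) \<le> f x\<^sub>0"
proof -
  have "f (X (Suc k)) \<le> f (X k)" for k
  proof -
    have "f (X (Suc k)) + D (X (Suc k)) (X k) / t \<le> f (X k)"
      using X unfolding discrete_flow_def by blast
    moreover have "0 \<le> D (X (Suc k)) (X k) / t" using D_nonneg t by simp
    ultimately show ?thesis by linarith
  qed
  then show ?thesis
    using lift_Suc_antimono_le[of "\<lambda>k. f (X k)" 0 k] X by (simp add: discrete_flow_def)
qed

text \<open>Summing the step lengths bounds the discrete flow only if \<open>\<alpha> \<le> 2\<close>; a discrete Gronwall argument
  for the divergence from the starting point works for every \<open>\<alpha>\<close>.\<close>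

lemma discrete_flow_bregman_bound:
  assumes X: "discrete_flow x\<^sub>0 t X" and t: "0 < t" "t * \<bar>lam\<bar> \<le> 1/2" and b: "\<And>y. fin y \<Longrightarrow> b \<le> f y"
  shows "D x\<^sub>0 (X k) \<le> exp (2 * \<bar>lam\<bar> * (k * t)) * (k * t) * (f x\<^sub>0 - b)"
proof (induction k)
  case 0
  then show ?case using X by (simp add: discrete_flow_def)
next
  case (Suc k)
  let ?L = "\<bar>lam\<bar>" and ?E = "exp (2 * \<bar>lam\<bar> * (k * t))"
  define c where "c = f x\<^sub>0 - b"
  have f0: "fin x\<^sub>0" using X unfolding discrete_flow_def by metis
  have c: "0 \<le> c" using b[OF f0] by (simp add: c_def)
  define d where "d = D x\<^sub>0 (X (Suc k))"
  have d: "0 \<le> d" unfolding d_def by (rule D_nonneg)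
  have "D x\<^sub>0 (X (Suc k)) - D x\<^sub>0 (X k) + D (X (Suc k)) (X k) \<le> t * (f x\<^sub>0 - f (X (Suc k)) - lam * D x\<^sub>0 (X (Suc k)))"
    using X f0 unfolding discrete_flow_def by blast
  then have "d \<le> D x\<^sub>0 (X k) + t * (f x\<^sub>0 - f (X (Suc k)) - lam * d)"
    using D_nonneg[of "X (Suc k)" "X k"] by (simp add: d_def)
  also have "t * (f x\<^sub>0 - f (X (Suc k)) - lam * d) \<le> t * (c + ?L * d)"
  proof (intro mult_left_mono)
    have "b \<le> f (X (Suc k))" using X b unfolding discrete_flow_def by blast
    moreover have "- lam * d \<le> ?L * d" using d by (intro mult_right_mono) auto
    ultimately show "f x\<^sub>0 - f (X (Suc k)) - lam * d \<le> c + ?L * d" by (simp add: c_def)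
  qed (use t in simp)
  finally have "(1 - t * ?L) * d \<le> D x\<^sub>0 (X k) + t * c" by (simp add: algebra_simps)
  \<comment> \<open>With \<open>h = t * ?L\<close> one has
    \<open>1 \<le> (1 + 2 * h) * (1 - h)\<close> as soon as \<open>0 \<le> h\<close> and
    \<open>h \<le> 1/2\<close>; this is the reason for the restriction on the step size.\<close>
  have "d \<le> (1 + 2 * ?L * t) * ((1 - t * ?L) * d)"
  proof -
    have "1 \<le> (1 + 2 * ?L * t) * (1 - t * ?L)"
    proof -
      have "0 \<le> (t * ?L) * (1 - 2 * (t * ?L))" using t by (intro mult_nonneg_nonneg) auto
      then show ?thesis by (simp add: algebra_simps)
    qed
    from mult_right_mono[OF this d] show ?thesis by (simp add: mult.assoc)
  qed
  also have "\<dots> \<le> (1 + 2 * ?L * t) * (D x\<^sub>0 (X k) + t * c)"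
    using t \<open>(1 - t * ?L) * d \<le> D x\<^sub>0 (X k) + t * c\<close> by (intro mult_left_mono) auto
  also have "\<dots> \<le> exp (2 * ?L * t) * (D x\<^sub>0 (X k) + t * c)"
    using D_nonneg[of "x\<^sub>0" "X k"] t c by (intro mult_right_mono exp_ge_add_one_self) simp
  also have "\<dots> \<le> exp (2 * ?L * t) * (?E * (k * t) * c + ?E * (t * c))"
  proof (intro mult_left_mono add_mono)
    show "D x\<^sub>0 (X k) \<le> ?E * (k * t) * c" using Suc.IH by (simp add: c_def)
    have "1 \<le> ?E" using t by simp
    from mult_right_mono[OF this, of "t * c"] show "t * c \<le> ?E * (t * c)" using t c by simp
  qed simp
  also have "\<dots> = (exp (2 * ?L * t) * ?E) * (Suc k * t) * c" by (simp add: algebra_simps)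
  also have "exp (2 * ?L * t) * ?E = exp (2 * ?L * (Suc k * t))"
    by (simp add: exp_add[symmetric] algebra_simps)
  finally show ?case by (simp add: d_def c_def)
qed

text \<open>A chain of constants depending on \<open>T\<close> but not on the step size: divergence
  from the start, norm of the iterates, norm of their gradients, lower bound of \<open>g\<close>.
  The last one lets the energy drop, which telescopes, control the squared gradient
  increments.\<close>

lemma discrete_flow_bounds:
  fixes T :: real
  assumes x0: "fin x\<^sub>0" and T: "0 \<le> T"
  obtains R C where "0 < R" "0 \<le> C"
    "\<And>(t::real) X (k::nat). discrete_flow x\<^sub>0 t X \<Longrightarrow> 0 < t \<Longrightarrow> t * \<bar>lam\<bar> \<le> 1/2 \<Longrightarrow> k * t \<le> T \<Longrightarrow> norm (X k) \<le> R"
    "\<And>(t::real) X (m::nat). discrete_flow x\<^sub>0 t X \<Longrightarrow> 0 < t \<Longrightarrow> t * \<bar>lam\<bar> \<le> 1/2 \<Longrightarrow> m * t \<le> T \<Longrightarrow>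
      (\<Sum>k<m. (norm (grad (X (Suc k)) - grad (X k)))\<^sup>2 / t) \<le> C\<^sup>2"
proof -
  obtain b where b: "\<And>y. fin y \<Longrightarrow> b \<le> f y" using f_bounded_below by blast
  have c: "0 \<le> f x\<^sub>0 - b" using b[OF x0] by simp
  define B where "B = exp (2 * \<bar>lam\<bar> * T) * T * (f x\<^sub>0 - b)"
  define R where "R = norm x\<^sub>0 + (C\<^sub>\<alpha> * B) powr (1/\<alpha>) + 1"
  have R: "0 < R" by (simp add: R_def add_nonneg_pos)
  have XR: "norm (X k) \<le> R"
    if X: "discrete_flow x\<^sub>0 t X" "0 < t" "t * \<bar>lam\<bar> \<le> 1/2" "k * t \<le> T" for t :: real and X and k :: nat
  proof -
    have "D x\<^sub>0 (X k) \<le> exp (2 * \<bar>lam\<bar> * (k * t)) * (k * t) * (f x\<^sub>0 - b)"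
      by (rule discrete_flow_bregman_bound[OF X(1-3) b])
    also have "\<dots> \<le> B" unfolding B_def using X(2,4) T c
      by (intro mult_right_mono mult_mono) (auto intro!: mult_left_mono)
    finally have "norm (x\<^sub>0 - X k) powr \<alpha> \<le> C\<^sub>\<alpha> * B"
      using Psi_unif_convex[rule_format, of x\<^sub>0 "X k"] alpha by (meson mult_left_mono less_imp_le order_trans)
    then have "norm (x\<^sub>0 - X k) \<le> (C\<^sub>\<alpha> * B) powr (1/\<alpha>)"
      using alpha by (intro powr_le_imp_le_powr_inverse) auto
    then show ?thesis using norm_triangle_ineq2[of "X k" x\<^sub>0] by (simp add: R_def norm_minus_commute)
  qed
  define U where "U = C\<^sub>\<beta> * R powr \<beta> + m\<^sub>\<beta>"
  have grad: "norm (grad x) \<le> U" if "norm x \<le> R" for x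
  proof -
    have "C\<^sub>\<beta> * norm x powr \<beta> \<le> C\<^sub>\<beta> * R powr \<beta>"
      using that beta by (intro mult_left_mono powr_mono2) auto
    then show ?thesis using grad_growth[rule_format, of x] by (simp add: U_def)
  qed
  obtain c0 where c0: "0 < c0" "\<And>r. 0 < r \<Longrightarrow> r \<le> 2 * U \<Longrightarrow> c0 \<le> g r"
    using positive_lower_bound_near_0[OF g_cont _ g_at_0, of "2 * U"] g_pos by blast
  \<comment> \<open>The bound on \<open>g\<close> is available at positive arguments only. Equal
    gradients, among them the case that both vanish, leave a zero left side and are treated
    apart.\<close>
  have lower: "c0 * (norm (grad y - grad x))\<^sup>2 \<le> D y x" if "norm x \<le> R" "norm y \<le> R" for x y
  proof (cases "grad y = grad x")
    case False
    then have "0 < norm (grad x) + norm (grad y)"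
      by (metis add_nonneg_eq_0_iff less_eq_real_def add_nonneg_nonneg norm_ge_zero norm_eq_zero)
    then have "c0 \<le> g (norm (grad x) + norm (grad y))"
      using grad[OF that(1)] grad[OF that(2)] by (intro c0(2)) auto
    then have "c0 * (norm (grad y - grad x))\<^sup>2 \<le> g (norm (grad x) + norm (grad y)) * (norm (grad x - grad y))\<^sup>2"
      by (simp add: norm_minus_commute mult_right_mono)
    also have "\<dots> \<le> bregman \<Psi>s (grad x) (grad y)" using Psis_bound by blast
    finally show ?thesis by (simp add: bregman_conjugate)
  qed (simp add: D_nonneg)
  \<comment> \<open>The total energy drop is at most \<open>f x\<^sub>0 - b\<close>, and each unit
    of it pays for \<open>1 / c0\<close> units of squared increments over \<open>t\<close>.\<close>
  define C where "C = sqrt ((f x\<^sub>0 - b) / c0)"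
  have energy: "(\<Sum>k<m. (norm (grad (X (Suc k)) - grad (X k)))\<^sup>2 / t) \<le> C\<^sup>2"
    if X: "discrete_flow x\<^sub>0 t X" "0 < t" "t * \<bar>lam\<bar> \<le> 1/2" "m * t \<le> T" for t :: real and X and m :: nat
  proof -
    have "(norm (grad (X (Suc k)) - grad (X k)))\<^sup>2 / t \<le> (f (X k) - f (X (Suc k))) / c0" if k: "k < m" for k
    proof -
      have "real (Suc k) * t \<le> real m * t" using k X(2) by (intro mult_right_mono of_nat_mono) auto
      moreover have "real k * t \<le> real m * t" using k X(2) by (intro mult_right_mono of_nat_mono) auto
      ultimately have "norm (X (Suc k)) \<le> R" "norm (X k) \<le> R"
        using X(4) by (auto intro!: XR[OF X(1-3)])
      then have "c0 * (norm (grad (X (Suc k)) - grad (X k)))\<^sup>2 \<le> D (X (Suc k)) (X k)" by (intro lower)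
      moreover have "f (X (Suc k)) + D (X (Suc k)) (X k) / t \<le> f (X k)"
        using X(1) unfolding discrete_flow_def by blast
      then have "D (X (Suc k)) (X k) \<le> t * (f (X k) - f (X (Suc k)))"
        using X(2) by (simp add: field_simps)
      ultimately have "c0 * (norm (grad (X (Suc k)) - grad (X k)))\<^sup>2 \<le> t * (f (X k) - f (X (Suc k)))" by linarith
      then show ?thesis using X(2) c0(1) by (simp add: field_simps)
    qed
    then have "(\<Sum>k<m. (norm (grad (X (Suc k)) - grad (X k)))\<^sup>2 / t) \<le> (\<Sum>k<m. (f (X k) - f (X (Suc k))) / c0)"
      by (intro sum_mono) auto
    also have "\<dots> = (f (X 0) - f (X m)) / c0"
      by (simp only: sum_divide_distrib[symmetric] sum_lessThan_telescope'[of "\<lambda>k. f (X k)"])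
    also have "\<dots> \<le> (f x\<^sub>0 - b) / c0"
    proof (intro divide_right_mono)
      have "b \<le> f (X m)" "X 0 = x\<^sub>0" using X(1) b unfolding discrete_flow_def by blast+
      then show "f (X 0) - f (X m) \<le> f x\<^sub>0 - b" by simp
    qed (use c0 in simp)
    finally show ?thesis using c c0(1) by (simp add: C_def)
  qed
  have "0 \<le> C" using c c0(1) by (simp add: C_def)
  show ?thesis
    by (rule that[OF R \<open>0 \<le> C\<close>]) (rule XR energy; assumption)+
qed

end

section \<open>Passage to the limit\<close>

lemma compact_diagonal_subsequence:
  fixes Y :: "nat \<Rightarrow> nat \<Rightarrow> 'a::metric_space"
  assumes K: "\<And>m. compact (K m)" and Y: "\<And>m n. Y m n \<in> K m"
  obtains r :: "nat \<Rightarrow> nat" where "strict_mono r" "\<And>m. convergent (\<lambda>n. Y m (r n))"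
proof -
  interpret subseqs "\<lambda>m s. convergent (\<lambda>n. Y m (s n))"
  proof
    fix m and s :: "nat \<Rightarrow> nat"
    assume "strict_mono s"
    have "\<forall>n. (Y m \<circ> s) n \<in> K m" using Y by simp
    then obtain l r where "strict_mono r" "((Y m \<circ> s) \<circ> r) \<longlonglongrightarrow> l"
      using K[of m] unfolding compact_def by blast
    then show "\<exists>r. strict_mono r \<and> convergent (\<lambda>n. Y m ((s \<circ> r) n))"
      by (auto simp: convergent_def o_def)
  qed
  \<comment> \<open>The diagonal sequence is a subsequence of the \<open>m\<close>-th extraction
    only from index \<open>Suc m\<close> on; convergence does not see the initial segment that is
    dropped.\<close>
  have *: "convergent (\<lambda>n. Y m ((diagseq \<circ> (+) (Suc m)) n))" for m
  proof (rule diagseq_holds)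
    show "convergent (\<lambda>n. Y k ((s \<circ> r) n))" if "strict_mono r" "convergent (\<lambda>n. Y k (s n))" for k r s
      using convergent_subseq_convergent[OF that(2,1)] by (simp add: o_def)
  qed
  have "convergent (\<lambda>n. Y m (diagseq (n + Suc m)))" for m
    using *[of m] by (subst add.commute) (simp add: o_def)
  then have "convergent (\<lambda>n. Y m (diagseq n))" for m
    by (subst (asm) convergent_ignore_initial_segment)
  then show ?thesis using subseq_diagseq that by blast
qed

text \<open>The discrete form of the estimate that curves with square integrable derivative are
  Hoelder continuous with exponent 1/2, again by Cauchy-Schwarz.\<close>

lemma norm_diff_le_sqrt_energy:
  fixes u :: "nat \<Rightarrow> 'b::real_normed_vector"
  assumes "j \<le> k"
  shows "norm (u k - u j) \<le> sqrt (real (k - j)) * sqrt (\<Sum>i<k. (norm (u (Suc i) - u i))\<^sup>2)"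
proof -
  have "norm (u k - u j) = norm (\<Sum>i=j..<k. u (Suc i) - u i)"
    using sum_Suc_diff'[OF assms, of u] by simp
  also have "\<dots> \<le> (\<Sum>i=j..<k. \<bar>1\<bar> * \<bar>norm (u (Suc i) - u i)\<bar>)"
    using norm_sum[of "\<lambda>i. u (Suc i) - u i" "{j..<k}"] by simp
  also have "\<dots> \<le> L2_set (\<lambda>_. 1) {j..<k} * L2_set (\<lambda>i. norm (u (Suc i) - u i)) {j..<k}"
    by (rule L2_set_mult_ineq)
  also have "\<dots> \<le> sqrt (real (k - j)) * sqrt (\<Sum>i<k. (norm (u (Suc i) - u i))\<^sup>2)"
    unfolding L2_set_def by (intro mult_mono real_sqrt_le_mono sum_mono2) (auto intro: sum_nonneg)
  finally show ?thesis .
qed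

lemma tendsto_floor_over:
  fixes p :: "nat \<Rightarrow> nat" and t :: real
  assumes p: "filterlim p at_top sequentially" "\<And>n. 0 < p n" and t: "0 \<le> t"
  shows "(\<lambda>n. real (nat \<lfloor>t * p n\<rfloor>) / p n) \<longlonglongrightarrow> t"
proof (rule real_tendsto_sandwich)
  have lim: "(\<lambda>n. 1 / real (p n)) \<longlonglongrightarrow> 0"
    using filterlim_compose[OF lim_1_over_n p(1)] by simp
  have *: "real (nat \<lfloor>t * p n\<rfloor>) = of_int \<lfloor>t * p n\<rfloor>" for n using t by simp
  show "eventually (\<lambda>n. t - 1 / p n \<le> real (nat \<lfloor>t * p n\<rfloor>) / p n) sequentially"
  proof (intro always_eventually allI)
    fix n
    have "t * p n - 1 \<le> real (nat \<lfloor>t * p n\<rfloor>)" unfolding * by linarith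
    then have "(t * p n - 1) / p n \<le> real (nat \<lfloor>t * p n\<rfloor>) / p n" by (rule divide_right_mono) simp
    then show "t - 1 / p n \<le> real (nat \<lfloor>t * p n\<rfloor>) / p n" using p(2)[of n] by (simp add: diff_divide_distrib)
  qed
  show "eventually (\<lambda>n. real (nat \<lfloor>t * p n\<rfloor>) / p n \<le> t) sequentially"
  proof (intro always_eventually allI)
    fix n
    have "real (nat \<lfloor>t * p n\<rfloor>) \<le> t * p n" unfolding * by linarith
    then show "real (nat \<lfloor>t * p n\<rfloor>) / p n \<le> t" using p(2)[of n] by (simp add: divide_le_eq)
  qed
  show "(\<lambda>n. t - 1 / p n) \<longlonglongrightarrow> t" using tendsto_diff[OF tendsto_const lim, of t] by simp
qed simp

context mirror_setting
begin

text \<open>The threshold inverts the Hoelder estimate with exponent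
  \<open>1 / (\<alpha> - 1)\<close>; taking \<open>e/2\<close> in it makes the conclusion
  strict.\<close>

lemma gradient_inverse_uniformly_continuous:
  assumes "0 < e"
  obtains d where "0 < d" "\<And>x y. norm (grad y - grad x) < d \<Longrightarrow> norm (y - x) < e"
proof (rule that[of "(e/2) powr (\<alpha> - 1) / C\<^sub>\<alpha>"])
  show "0 < (e/2) powr (\<alpha> - 1) / C\<^sub>\<alpha>" using assms alpha by simp
  fix x y assume "norm (grad y - grad x) < (e/2) powr (\<alpha> - 1) / C\<^sub>\<alpha>"
  then have "C\<^sub>\<alpha> * norm (grad y - grad x) \<le> (e/2) powr (\<alpha> - 1)"
    using alpha by (simp add: field_simps)
  then have "(C\<^sub>\<alpha> * norm (grad y - grad x)) powr (1 / (\<alpha> - 1)) \<le> ((e/2) powr (\<alpha> - 1)) powr (1 / (\<alpha> - 1))"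
    using alpha by (intro powr_mono2) auto
  also have "\<dots> = e/2" using alpha assms by (simp add: powr_powr)
  finally show "norm (y - x) < e" using norm_diff_le_gradient_diff[of y x] assms by linarith
qed

text \<open>The limit of the gradients is not known to be a gradient. Instead \<open>Y\<close> is
  Cauchy by uniform continuity of the inverse, and completeness of the primal space provides the
  limit.\<close>

lemma convergent_if_gradient_convergent:
  assumes "convergent (\<lambda>n. grad (Y n))"
  shows "convergent Y"
proof (rule Cauchy_convergent, rule CauchyI)
  fix e :: real assume "0 < e"
  then obtain d where d: "0 < d" "\<And>x y. norm (grad y - grad x) < d \<Longrightarrow> norm (y - x) < e"
    using gradient_inverse_uniformly_continuous by blast
  have "Cauchy (\<lambda>n. grad (Y n))" using assms by (rule convergent_Cauchy)
  then obtain N where "\<forall>m\<ge>N. \<forall>n\<ge>N. norm (grad (Y m) - grad (Y n)) < d" using CauchyD d(1) by blast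
  then show "\<exists>N. \<forall>m\<ge>N. \<forall>n\<ge>N. norm (Y m - Y n) < e" using d(2) by blast
qed

lemma tendsto_D: "(X \<longlongrightarrow> x) F \<Longrightarrow> ((\<lambda>n. D y (X n)) \<longlongrightarrow> D y x) F"
  unfolding bregman_def
  by (intro tendsto_intros tendsto_Psi tendsto_gradient bounded_bilinear.tendsto[OF bounded_bilinear_blinfun_apply]) auto

text \<open>Differentiability of \<Psi> at \<open>x\<close> makes \<open>D y x\<close> small
  compared with \<open>norm (y - x)\<close>, so the error \<open>lam * D y x\<close> disappears in
  the Frechet quotient whatever the sign of \<open>lam\<close>.\<close>

lemma frechet_subdifferentialI:
  assumes x: "fin x" and le: "\<And>y. fin y \<Longrightarrow> lam * D y x \<le> f y - f x - blinfun_apply \<xi> (y - x)"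
  shows "\<xi> \<in> frechet_subdifferential \<Phi> x"
proof -
  let ?q = "\<lambda>y. (\<Phi> y - \<Phi> x - ereal (blinfun_apply \<xi> (y - x))) / ereal (norm (y - x))"
  have "0 \<le> Liminf (at x) ?q"
    unfolding le_Liminf_iff
  proof (intro allI impI)
    fix c :: ereal assume "c < 0"
    then obtain c' :: real where c': "c < ereal c'" "c' < 0"
      using ereal_dense2[of c 0] by (auto simp: zero_ereal_def)
    \<comment> \<open>Chosen to give \<open>\<bar>lam\<bar> * e \<le> - c'\<close>; the added 1
      covers \<open>lam = 0\<close>.\<close>
    define e where "e = - c' / (\<bar>lam\<bar> + 1)"
    have e: "0 < e" unfolding e_def using c' by (intro divide_pos_pos) auto
    have le_e: "\<bar>lam\<bar> * e \<le> - c'"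
      using c' by (simp add: e_def field_simps)
    obtain d where d: "0 < d" "\<And>y. norm (y - x) < d \<Longrightarrow> norm (\<Psi> y - \<Psi> x - blinfun_apply (grad x) (y - x)) \<le> e * norm (y - x)"
      using Psi_derivative[of x] e unfolding has_derivative_at_alt by blast
    have "c < ?q y" if y: "y \<noteq> x" "dist y x < d" for y
    proof (cases "fin y")
      case False
      then have "\<Phi> y = \<infinity>" by simp
      moreover have "c \<noteq> \<infinity>" using c' by auto
      ultimately show ?thesis using y by (simp add: Phi_eq[OF x])
    next
      case True
      have "norm (D y x) \<le> e * norm (y - x)" using d(2)[of y] y by (simp add: bregman_def dist_norm)
      then have "\<bar>lam\<bar> * \<bar>D y x\<bar> \<le> \<bar>lam\<bar> * (e * norm (y - x))" by (intro mult_left_mono) auto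
      also have "\<dots> \<le> - c' * norm (y - x)" using mult_right_mono[OF le_e norm_ge_zero[of "y - x"]] by (simp add: mult.assoc)
      finally have "\<bar>lam * D y x\<bar> \<le> - c' * norm (y - x)" by (simp add: abs_mult)
      then have "c' * norm (y - x) \<le> lam * D y x" by (simp add: abs_le_iff)
      also note le[OF True]
      finally have "c' \<le> (f y - f x - blinfun_apply \<xi> (y - x)) / norm (y - x)" using y by (simp add: le_divide_eq)
      then have "ereal c' \<le> ?q y" using y by (simp add: Phi_eq[OF x] Phi_eq[OF True])
      with c'(1) show ?thesis by (rule less_le_trans)
    qed
    then show "eventually (\<lambda>y. c < ?q y) (at x)"
      using d(1) by (auto simp: eventually_at)
  qed
  then show ?thesis using x by (simp add: frechet_subdifferential_def)
qed

text \<open>The scheme is implicit, each step being estimated at its new point; hence the bound is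
  required for \<open>j < i\<close> but not at \<open>j\<close> itself.\<close>

lemma discrete_flow_bregman_diff_le:
  assumes X: "discrete_flow x\<^sub>0 t X" and y: "fin y" and t: "0 < t" and jk: "j \<le> k"
    and le: "\<And>i. j < i \<Longrightarrow> i \<le> k \<Longrightarrow> f y - f (X i) - lam * D y (X i) \<le> c"
  shows "D y (X k) - D y (X j) \<le> (real k - real j) * t * c"
proof -
  have "D y (X k) - D y (X j) = (\<Sum>i=j..<k. D y (X (Suc i)) - D y (X i))"
    using sum_Suc_diff'[OF jk, of "\<lambda>i. D y (X i)"] by simp
  also have "\<dots> \<le> (\<Sum>i=j..<k. t * c)"
  proof (rule sum_mono)
    fix i assume i: "i \<in> {j..<k}"
    have "D y (X (Suc i)) - D y (X i) + D (X (Suc i)) (X i) \<le> t * (f y - f (X (Suc i)) - lam * D y (X (Suc i)))"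
      using X y unfolding discrete_flow_def by blast
    also have "\<dots> \<le> t * c" using i t by (intro mult_left_mono le) auto
    finally show "D y (X (Suc i)) - D y (X i) \<le> t * c" using D_nonneg[of "X (Suc i)" "X i"] by linarith
  qed
  also have "\<dots> = (real k - real j) * t * c" using jk by (simp add: of_nat_diff)
  finally show ?thesis .
qed

text \<open>Compactness of sublevel pieces and a diagonal argument give convergence at rational
  times. Equicontinuity of the gradients carries it to all times, but only for the gradients; the
  inverse of the gradient map brings it back to the iterates.\<close>

lemma discrete_flows_limit:
  assumes x0: "fin x\<^sub>0"
  obtains p :: "nat \<Rightarrow> nat" and X :: "nat \<Rightarrow> nat \<Rightarrow> 'a" and x :: "real \<Rightarrow> 'a"
  where "\<And>n. 0 < p n" "filterlim p at_top sequentially" "\<And>n. discrete_flow x\<^sub>0 (1 / p n) (X n)"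
    "\<And>t::real. 0 \<le> t \<Longrightarrow> (\<lambda>n. X n (nat \<lfloor>t * p n\<rfloor>)) \<longlonglongrightarrow> x t"
    "\<And>T::real. 0 \<le> T \<Longrightarrow> \<exists>C\<ge>0. \<forall>n m. real m \<le> T * p n \<longrightarrow>
      (\<Sum>k<m. real (p n) * (norm (grad (X n (Suc k)) - grad (X n k)))\<^sup>2) \<le> C\<^sup>2"
proof -
  \<comment> \<open>The shift by \<open>n0\<close> makes every step size admissible for the discrete
    Gronwall bound, so that no statement has to be restricted to large \<open>n\<close>.\<close>
  obtain n0 :: nat where n0: "2 * \<bar>lam\<bar> + 1 \<le> n0" using real_arch_simple by blast
  define P where "P n = n + n0" for n
  have P: "0 < P n" "1 / P n * \<bar>lam\<bar> \<le> 1/2" for n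
  proof -
    have "1 \<le> real n0" using n0 by linarith
    then show "0 < P n" by (simp add: P_def)
    moreover have "2 * \<bar>lam\<bar> \<le> real (P n)" using n0 by (simp add: P_def)
    ultimately show "1 / P n * \<bar>lam\<bar> \<le> 1/2" by (simp add: field_simps)
  qed
  have "\<exists>X. discrete_flow x\<^sub>0 (1 / P n) X" for n
    using discrete_flow_exists[OF x0, of "1 / P n"] P(1)[of n] by auto
  then obtain X where X: "\<And>n. discrete_flow x\<^sub>0 (1 / P n) (X n)" by metis
  have bounds: "\<exists>R C. 0 < R \<and> 0 \<le> C \<and> (\<forall>n k. real k \<le> T * P n \<longrightarrow> norm (X n k) \<le> R) \<and>
     (\<forall>n m. real m \<le> T * P n \<longrightarrow> (\<Sum>k<m. real (P n) * (norm (grad (X n (Suc k)) - grad (X n k)))\<^sup>2) \<le> C\<^sup>2)"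
    if T: "0 \<le> T" for T :: real
  proof -
    obtain R C where RC: "0 < R" "0 \<le> C"
      "\<And>(t::real) X (k::nat). discrete_flow x\<^sub>0 t X \<Longrightarrow> 0 < t \<Longrightarrow> t * \<bar>lam\<bar> \<le> 1/2 \<Longrightarrow> k * t \<le> T \<Longrightarrow> norm (X k) \<le> R"
      "\<And>(t::real) X (m::nat). discrete_flow x\<^sub>0 t X \<Longrightarrow> 0 < t \<Longrightarrow> t * \<bar>lam\<bar> \<le> 1/2 \<Longrightarrow> m * t \<le> T \<Longrightarrow>
        (\<Sum>k<m. (norm (grad (X (Suc k)) - grad (X k)))\<^sup>2 / t) \<le> C\<^sup>2"
      by (rule discrete_flow_bounds[OF x0 T]) (rule that, assumption+)
    have conv: "real k * (1 / P n) \<le> T" if "real k \<le> T * P n" for k n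
      using that P(1)[of n] by (simp add: field_simps)
    show ?thesis
    proof (rule exI[of _ R], rule exI[of _ C], intro conjI allI impI RC(1,2))
      show "norm (X n k) \<le> R" if "real k \<le> T * P n" for n k
        by (rule RC(3)[OF X _ P(2) conv[OF that]]) (use P(1) in simp)
      show "(\<Sum>k<m. real (P n) * (norm (grad (X n (Suc k)) - grad (X n k)))\<^sup>2) \<le> C\<^sup>2" if "real m \<le> T * P n" for n m
        using RC(4)[OF X _ P(2) conv[OF that]] P(1)[of n] by (simp add: mult.commute)
    qed
  qed
  have floor_le: "real (nat \<lfloor>t * P n\<rfloor>) \<le> t * P n" if "0 \<le> t" for t :: real and n
    using that by simp
  have "\<exists>K. compact K \<and> (\<forall>n. X n (nat \<lfloor>q * P n\<rfloor>) \<in> K)" if q: "0 \<le> q" for q :: real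
  proof -
    obtain R where R: "0 < R" "\<forall>n k. real k \<le> q * P n \<longrightarrow> norm (X n k) \<le> R" using bounds[OF q] by blast
    have XK: "X n k \<in> {z. norm z \<le> R \<and> \<Phi> z \<le> ereal (f x\<^sub>0)}" if "real k \<le> q * P n" for n k
    proof -
      have "fin (X n k)" using X[of n] unfolding discrete_flow_def by blast
      moreover have "f (X n k) \<le> f x\<^sub>0" using discrete_flow_energy[OF X] P(1)[of n] by simp
      ultimately show ?thesis using R that by (simp add: Phi_eq)
    qed
    have "compact {z. norm z \<le> R \<and> \<Phi> z \<le> ereal (f x\<^sub>0)}" using Phi_compact R(1) by simp
    then show ?thesis using XK[OF floor_le[OF q]] by (intro exI conjI allI)
  qed
  then have "\<exists>K. \<forall>q::real. 0 \<le> q \<longrightarrow> compact (K q) \<and> (\<forall>n. X n (nat \<lfloor>q * P n\<rfloor>) \<in> K q)" by metis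
  then obtain K where K: "\<And>q. 0 \<le> q \<Longrightarrow> compact (K q)" "\<And>(q::real) n. 0 \<le> q \<Longrightarrow> X n (nat \<lfloor>q * P n\<rfloor>) \<in> K q" by blast
  define Q :: "real set" where "Q = \<rat> \<inter> {0..}"
  have Q: "countable Q" "Q \<noteq> {}" unfolding Q_def by (auto simp: countable_rat intro: countable_subset)
  then have Qm: "0 \<le> from_nat_into Q m" for m using from_nat_into[OF Q(2), of m] by (simp add: Q_def)
  obtain r where r: "strict_mono r"
    "\<And>m. convergent (\<lambda>n. X (r n) (nat \<lfloor>from_nat_into Q m * P (r n)\<rfloor>))"
    using compact_diagonal_subsequence[of "\<lambda>m. K (from_nat_into Q m)"
      "\<lambda>m n. X n (nat \<lfloor>from_nat_into Q m * P n\<rfloor>)"] K Qm by blast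
  define p where "p n = P (r n)" for n
  define Z where "Z n = X (r n)" for n
  have p: "0 < p n" for n by (simp add: p_def P)
  have p_lim: "filterlim p at_top sequentially"
  proof (rule filterlim_at_top_mono)
    show "filterlim (\<lambda>n::nat. n) at_top sequentially" by (rule filterlim_ident)
    show "eventually (\<lambda>n. n \<le> p n) sequentially"
      using seq_suble[OF r(1)] by (intro always_eventually allI) (simp add: p_def P_def trans_le_add1)
  qed
  have p_inv: "(\<lambda>n. 1 / real (p n)) \<longlonglongrightarrow> 0"
    using filterlim_compose[OF lim_1_over_n p_lim] by simp
  have Z: "discrete_flow x\<^sub>0 (1 / p n) (Z n)" for n by (simp add: p_def Z_def X)
  have en: "\<exists>C\<ge>0. \<forall>n m. real m \<le> T * p n \<longrightarrow>
      (\<Sum>k<m. real (p n) * (norm (grad (Z n (Suc k)) - grad (Z n k)))\<^sup>2) \<le> C\<^sup>2" if T: "0 \<le> T" for T :: real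
  proof -
    obtain C where C: "0 \<le> C" "\<forall>n m. real m \<le> T * P n \<longrightarrow>
      (\<Sum>k<m. real (P n) * (norm (grad (X n (Suc k)) - grad (X n k)))\<^sup>2) \<le> C\<^sup>2"
      using bounds[OF T] by blast
    show ?thesis
      using C(2) by (intro exI[of _ C] conjI allI impI C(1)) (simp add: p_def Z_def)
  qed
  have conv_Q: "convergent (\<lambda>n. Z n (nat \<lfloor>q * p n\<rfloor>))" if "q \<in> Q" for q
    using r(2)[of "to_nat_on Q q"] from_nat_into_to_nat_on[OF Q(1) that] by (simp add: p_def Z_def)
  have conv: "convergent (\<lambda>n. grad (Z n (nat \<lfloor>t * p n\<rfloor>)))" if t: "0 \<le> t" for t :: real
  proof (rule convergent_if_approximable)
    fix e :: real assume e: "0 < e"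
    obtain C where C: "0 \<le> C" "\<And>n m. real m \<le> (t + 1) * p n \<Longrightarrow>
      (\<Sum>k<m. real (p n) * (norm (grad (Z n (Suc k)) - grad (Z n k)))\<^sup>2) \<le> C\<^sup>2" using en[of "t + 1"] t by auto
    \<comment> \<open>Makes \<open>C * sqrt (2 * \<delta>) \<le> e\<close>, with
      \<open>C + 1\<close> in place of \<open>C\<close> against division by zero; the cap 1 keeps
      \<open>q\<close> inside the horizon \<open>t + 1\<close> for which \<open>C\<close> was
      chosen.\<close>
    define \<delta> where "\<delta> = min 1 ((e / (C + 1))\<^sup>2 / 2)"
    have \<delta>: "0 < \<delta>" "\<delta> \<le> 1" using e C(1) by (auto simp: \<delta>_def)
    have C\<delta>: "C * sqrt (2 * \<delta>) \<le> e"
    proof -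
      have "sqrt (2 * \<delta>) \<le> sqrt ((e / (C + 1))\<^sup>2)" by (intro real_sqrt_le_mono) (simp add: \<delta>_def)
      also have "\<dots> = e / (C + 1)" using e C(1) by simp
      finally have "C * sqrt (2 * \<delta>) \<le> C * (e / (C + 1))" using C(1) by (rule mult_left_mono)
      also have "\<dots> \<le> e" using e C(1) by (simp add: field_simps)
      finally show ?thesis .
    qed
    obtain q where q: "q \<in> \<rat>" "t < q" "q < t + \<delta>" using Rats_dense_in_real[of t "t + \<delta>"] \<delta> by auto
    then have "q \<in> Q" using t by (simp add: Q_def)
    then have "convergent (\<lambda>n. grad (Z n (nat \<lfloor>q * p n\<rfloor>)))"
      using conv_Q tendsto_gradient unfolding convergent_def by blast
    moreover have "eventually (\<lambda>n. norm (grad (Z n (nat \<lfloor>t * p n\<rfloor>)) - grad (Z n (nat \<lfloor>q * p n\<rfloor>))) \<le> e) sequentially"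
      using order_tendstoD(2)[OF p_inv \<delta>(1)]
    proof eventually_elim
      case (elim n)
      let ?j = "nat \<lfloor>t * p n\<rfloor>" and ?k = "nat \<lfloor>q * p n\<rfloor>"
      have jk: "?j \<le> ?k" using q p[of n] by (intro nat_mono floor_mono mult_right_mono) auto
      have k: "real ?k \<le> q * p n" using q t by simp
      also have "\<dots> \<le> (t + 1) * p n" using q \<delta> by (intro mult_right_mono) auto
      finally have "(\<Sum>i<?k. real (p n) * (norm (grad (Z n (Suc i)) - grad (Z n i)))\<^sup>2) \<le> C\<^sup>2" by (rule C(2))
      then have S: "(\<Sum>i<?k. (norm (grad (Z n (Suc i)) - grad (Z n i)))\<^sup>2) \<le> C\<^sup>2 / p n"
        using p[of n] by (simp add: sum_distrib_left[symmetric] field_simps)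
      have "t * p n - 1 \<le> real ?j" using t by linarith
      then have "real (?k - ?j) \<le> (q - t) * p n + 1" using k jk by (simp add: of_nat_diff left_diff_distrib)
      \<comment> \<open>Rounding to the grid costs at most one step, and for large \<open>n\<close>
        a step is shorter than \<open>\<delta>\<close>; hence the factor 2.\<close>
      also have "\<dots> \<le> 2 * \<delta> * p n"
      proof -
        have "(q - t) * p n \<le> \<delta> * p n" using q by (intro mult_right_mono) auto
        moreover have "1 \<le> \<delta> * p n" using elim p[of n] by (simp add: field_simps)
        ultimately show ?thesis by simp
      qed
      finally have kj: "real (?k - ?j) \<le> 2 * \<delta> * p n" .
      have "norm (grad (Z n ?k) - grad (Z n ?j)) \<le> sqrt (real (?k - ?j)) * sqrt (\<Sum>i<?k. (norm (grad (Z n (Suc i)) - grad (Z n i)))\<^sup>2)"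
        using norm_diff_le_sqrt_energy[OF jk, of "\<lambda>i. grad (Z n i)"] by simp
      also have "\<dots> \<le> sqrt (2 * \<delta> * p n) * sqrt (C\<^sup>2 / p n)"
        using S kj \<delta>(1) by (intro mult_mono real_sqrt_le_mono) (auto intro: sum_nonneg)
      also have "\<dots> = C * sqrt (2 * \<delta>)" using p[of n] C(1) by (simp add: real_sqrt_mult real_sqrt_divide)
      also note C\<delta>
      finally show ?case by (simp add: norm_minus_commute)
    qed
    ultimately show "\<exists>Y. convergent Y \<and> eventually (\<lambda>n. norm (grad (Z n (nat \<lfloor>t * p n\<rfloor>)) - Y n) \<le> e) sequentially"
      by blast
  qed
  show ?thesis
  proof (rule that[of p Z "\<lambda>t. lim (\<lambda>n. Z n (nat \<lfloor>t * p n\<rfloor>))"])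
    show "(\<lambda>n. Z n (nat \<lfloor>t * p n\<rfloor>)) \<longlonglongrightarrow> lim (\<lambda>n. Z n (nat \<lfloor>t * p n\<rfloor>))" if "0 \<le> t" for t :: real
      using convergent_if_gradient_convergent[OF conv[OF that]] by (simp add: convergent_LIMSEQ_iff)
  qed (use p p_lim Z en in auto)
qed

text \<open>The evolution variational inequality needs no integral of \<open>f (x r)\<close>: lower semicontinuity at the
  single point \<open>x s\<close> bounds all the discrete energies at times close to \<open>s\<close>.\<close>

lemma limit_variational_inequality:
  fixes p :: "nat \<Rightarrow> nat" and x :: "real \<Rightarrow> 'a"
  assumes p: "\<And>n. 0 < p n" "filterlim p at_top sequentially"
    and X: "\<And>n. discrete_flow x\<^sub>0 (1 / p n) (X n)"
    and lim: "\<And>t::real. 0 \<le> t \<Longrightarrow> (\<lambda>n. X n (nat \<lfloor>t * p n\<rfloor>)) \<longlonglongrightarrow> x t"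
    and energy: "\<And>T::real. 0 \<le> T \<Longrightarrow> \<exists>C\<ge>0. \<forall>n m. real m \<le> T * p n \<longrightarrow>
      (\<Sum>k<m. real (p n) * (norm (grad (X n (Suc k)) - grad (X n k)))\<^sup>2) \<le> C\<^sup>2"
    and s: "0 \<le> s" and fs: "fin (x s)" and y: "fin y" and e: "0 < e"
  shows "\<exists>\<delta>>0. \<forall>t. s < t \<longrightarrow> t < s + \<delta> \<longrightarrow>
    D y (x t) - D y (x s) \<le> (t - s) * (f y - f (x s) - lam * D y (x s) + e)"
proof -
  \<comment> \<open>The tolerance \<open>e\<close> is shared: one part \<open>e'\<close> for the
    drop of \<open>f\<close> below \<open>f (x s)\<close>, and \<open>\<bar>lam\<bar>\<close> parts
    for the variation of \<open>D y\<close>.\<close>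
  define e' where "e' = e / (1 + \<bar>lam\<bar>)"
  have e': "0 < e'" "(1 + \<bar>lam\<bar>) * e' = e" using e by (auto simp: e'_def add_pos_nonneg)
  have "ereal (f (x s) - e') < \<Phi> (x s)" using e' by (simp add: Phi_eq[OF fs])
  then obtain d1 where d1: "0 < d1" "\<And>z. dist z (x s) < d1 \<Longrightarrow> ereal (f (x s) - e') < \<Phi> z"
    using Phi_lower_nbhd by blast
  have "((\<lambda>z. D y z) \<longlongrightarrow> D y (x s)) (nhds (x s))" by (rule tendsto_D) (rule filterlim_ident)
  then have "eventually (\<lambda>z. dist (D y z) (D y (x s)) < e') (nhds (x s))" using e'(1) by (rule tendstoD)
  then obtain d2 where d2: "0 < d2" "\<And>z. dist z (x s) < d2 \<Longrightarrow> dist (D y z) (D y (x s)) < e'"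
    by (auto simp: eventually_nhds_metric)
  have "0 < min d1 d2" using d1 d2 by simp
  then obtain \<eta> where \<eta>: "0 < \<eta>" "\<And>w z. norm (grad z - grad w) < \<eta> \<Longrightarrow> norm (z - w) < min d1 d2"
    using gradient_inverse_uniformly_continuous by blast
  define c where "c = f y - f (x s) - lam * D y (x s) + e"
  have near: "f y - f z - lam * D y z \<le> c" if z: "norm (grad z - grad (x s)) < \<eta>" "fin z" for z
  proof -
    have d: "dist z (x s) < d1" "dist z (x s) < d2" using \<eta>(2)[OF z(1)] by (auto simp: dist_norm)
    have "f (x s) - e' < f z" using d1(2)[OF d(1)] by (simp add: Phi_eq[OF z(2)])
    moreover have "- lam * (D y z - D y (x s)) \<le> \<bar>lam\<bar> * e'"
    proof -
      have "- lam * (D y z - D y (x s)) \<le> \<bar>lam\<bar> * \<bar>D y z - D y (x s)\<bar>"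
        by (metis abs_ge_self abs_minus_cancel abs_mult)
      also have "\<dots> \<le> \<bar>lam\<bar> * e'" using d2(2)[OF d(2)] by (intro mult_left_mono) (auto simp: dist_real_def)
      finally show ?thesis .
    qed
    ultimately show ?thesis using e'(2) by (simp add: c_def algebra_simps)
  qed
  obtain C where C: "0 \<le> C" "\<forall>n m. real m \<le> (s + 1) * p n \<longrightarrow>
      (\<Sum>k<m. real (p n) * (norm (grad (X n (Suc k)) - grad (X n k)))\<^sup>2) \<le> C\<^sup>2"
    using energy[of "s + 1"] s by auto
  \<comment> \<open>One third of \<open>\<eta>\<close> bounds the motion of the discrete gradients
    between the times \<open>s\<close> and \<open>t\<close>, another the distance from the discrete
    gradient at time \<open>s\<close> to its limit. Together they stay strictly below
    \<open>\<eta>\<close>.\<close>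
  define \<delta> where "\<delta> = min 1 ((\<eta> / (3 * (C + 1)))\<^sup>2 / 2)"
  have \<delta>: "0 < \<delta>" "\<delta> \<le> 1" using \<eta>(1) C(1) by (auto simp: \<delta>_def)
  have C\<delta>: "C * sqrt (2 * \<delta>) \<le> \<eta> / 3"
  proof -
    have "sqrt (2 * \<delta>) \<le> sqrt ((\<eta> / (3 * (C + 1)))\<^sup>2)" by (intro real_sqrt_le_mono) (simp add: \<delta>_def)
    also have "\<dots> = \<eta> / (3 * (C + 1))" using \<eta>(1) C(1) by simp
    finally have "C * sqrt (2 * \<delta>) \<le> C * (\<eta> / (3 * (C + 1)))" using C(1) by (rule mult_left_mono)
    also have "\<dots> \<le> \<eta> / 3" using \<eta>(1) C(1) by (simp add: field_simps)
    finally show ?thesis .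
  qed
  have "D y (x t) - D y (x s) \<le> (t - s) * c" if t: "s < t" "t < s + \<delta>" for t
  proof -
    let ?j = "\<lambda>n. nat \<lfloor>s * p n\<rfloor>" and ?k = "\<lambda>n. nat \<lfloor>t * p n\<rfloor>"
    have t0: "0 \<le> t" using s t by simp
    have p_inv: "(\<lambda>n. 1 / real (p n)) \<longlonglongrightarrow> 0"
      using filterlim_compose[OF lim_1_over_n p(2)] by simp
    have "(\<lambda>n. grad (X n (?j n))) \<longlonglongrightarrow> grad (x s)" using lim[OF s] by (rule tendsto_gradient)
    then have "eventually (\<lambda>n. norm (grad (X n (?j n)) - grad (x s)) < \<eta> / 3) sequentially"
      using tendstoD[of _ "grad (x s)" sequentially "\<eta> / 3"] \<eta>(1) by (simp add: dist_norm)
    then have ev: "eventually (\<lambda>n. D y (X n (?k n)) - D y (X n (?j n)) \<le> (real (?k n) / p n - real (?j n) / p n) * c) sequentially"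
      using order_tendstoD(2)[OF p_inv \<delta>(1)]
    proof eventually_elim
      case (elim n)
      have jk: "?j n \<le> ?k n" using t by (intro nat_mono floor_mono mult_right_mono) auto
      have k: "real (?k n) \<le> t * p n" using t0 by simp
      have j: "s * p n - 1 \<le> real (?j n)" using s by linarith
      have kT: "real (?k n) \<le> (s + 1) * p n"
        using k t \<delta>(2) by (rule_tac order_trans[OF k], intro mult_right_mono) auto
      have near_i: "f y - f (X n i) - lam * D y (X n i) \<le> c" if i: "?j n < i" "i \<le> ?k n" for i
      proof (rule near)
        show "fin (X n i)" using X[of n] unfolding discrete_flow_def by blast
        have ik: "real i \<le> real (?k n)" using i(2) by (rule of_nat_mono)
        then have "(\<Sum>l<i. real (p n) * (norm (grad (X n (Suc l)) - grad (X n l)))\<^sup>2) \<le> C\<^sup>2"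
          using C(2) kT order_trans by blast
        then have S: "(\<Sum>l<i. (norm (grad (X n (Suc l)) - grad (X n l)))\<^sup>2) \<le> C\<^sup>2 / p n"
          using p(1)[of n] by (simp add: sum_distrib_left[symmetric] field_simps)
        have "real (i - ?j n) = real i - real (?j n)" using i by (intro of_nat_diff) simp
        then have "real (i - ?j n) \<le> (t - s) * p n + 1" using k j ik by (simp add: left_diff_distrib)
        also have "\<dots> \<le> 2 * \<delta> * p n"
        proof -
          have "(t - s) * p n \<le> \<delta> * p n" using t by (intro mult_right_mono) auto
          moreover have "1 \<le> \<delta> * p n" using elim(2) p(1)[of n] by (simp add: field_simps)
          ultimately show ?thesis by simp
        qed
        finally have ij: "real (i - ?j n) \<le> 2 * \<delta> * p n" .
        have "norm (grad (X n i) - grad (X n (?j n))) \<le> sqrt (real (i - ?j n)) * sqrt (\<Sum>l<i. (norm (grad (X n (Suc l)) - grad (X n l)))\<^sup>2)"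
          using norm_diff_le_sqrt_energy[of "?j n" i "\<lambda>i. grad (X n i)"] i by simp
        also have "\<dots> \<le> sqrt (2 * \<delta> * p n) * sqrt (C\<^sup>2 / p n)"
          using S ij \<delta>(1) by (intro mult_mono real_sqrt_le_mono) (auto intro: sum_nonneg)
        also have "\<dots> = C * sqrt (2 * \<delta>)" using p(1)[of n] C(1) by (simp add: real_sqrt_mult real_sqrt_divide)
        also note C\<delta>
        finally have "norm (grad (X n i) - grad (X n (?j n))) \<le> \<eta> / 3" .
        then show "norm (grad (X n i) - grad (x s)) < \<eta>"
          using elim(1) \<eta>(1) norm_triangle_ineq[of "grad (X n i) - grad (X n (?j n))" "grad (X n (?j n)) - grad (x s)"]
          by simp
      qed
      have "D y (X n (?k n)) - D y (X n (?j n)) \<le> (real (?k n) - real (?j n)) * (1 / p n) * c"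
        by (rule discrete_flow_bregman_diff_le[OF X y _ jk near_i]) (use p(1)[of n] in auto)
      then show ?case by (simp add: diff_divide_distrib)
    qed
    have l1: "(\<lambda>n. D y (X n (?k n)) - D y (X n (?j n))) \<longlonglongrightarrow> D y (x t) - D y (x s)"
      by (intro tendsto_diff tendsto_D lim s t0)
    have l2: "(\<lambda>n. (real (?k n) / p n - real (?j n) / p n) * c) \<longlonglongrightarrow> (t - s) * c"
      by (intro tendsto_intros tendsto_floor_over p s t0)
    show ?thesis by (rule tendsto_le[OF trivial_limit_sequentially l2 l1 ev])
  qed
  then show ?thesis using \<delta>(1) unfolding c_def by blast
qed

lemma subdifferential_if_variational_inequality:
  fixes x :: "real \<Rightarrow> 'a"
  assumes der: "((\<lambda>t. grad (x t)) has_vector_derivative v) (at s)" and fs: "fin (x s)"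
    and evi: "\<And>y e. fin y \<Longrightarrow> 0 < e \<Longrightarrow> \<exists>\<delta>>0. \<forall>t. s < t \<longrightarrow> t < s + \<delta> \<longrightarrow>
      D y (x t) - D y (x s) \<le> (t - s) * (f y - f (x s) - lam * D y (x s) + e)"
  shows "- v \<in> frechet_subdifferential \<Phi> (x s)"
proof (rule frechet_subdifferentialI[OF fs])
  fix y assume y: "fin y"
  define w where "w = x s - y"
  define c where "c = f y - f (x s) - lam * D y (x s)"
  have "((\<lambda>t. blinfun_apply (grad (x t)) w) has_vector_derivative blinfun_apply v w) (at s)"
    by (rule bounded_linear.has_vector_derivative[OF _ der]) (intro bounded_linear_intros)
  then have "((\<lambda>t. blinfun_apply (grad (x t)) w) has_real_derivative blinfun_apply v w) (at s)"
    by (simp add: has_real_derivative_iff_has_vector_derivative)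
  then have "((\<lambda>t. (blinfun_apply (grad (x t)) w - blinfun_apply (grad (x s)) w) / (t - s)) \<longlongrightarrow> blinfun_apply v w) (at s)"
    by (simp add: has_field_derivative_iff)
  then have lim: "((\<lambda>t. (blinfun_apply (grad (x t)) w - blinfun_apply (grad (x s)) w) / (t - s)) \<longlongrightarrow> blinfun_apply v w) (at_right s)"
    by (simp add: filterlim_at_split)
  have "blinfun_apply v w \<le> c + e" if e: "0 < e" for e
  proof -
    obtain \<delta> where \<delta>: "0 < \<delta>" "\<And>t. s < t \<Longrightarrow> t < s + \<delta> \<Longrightarrow>
      D y (x t) - D y (x s) \<le> (t - s) * (c + e)" using evi[OF y e] unfolding c_def by blast
    have "(blinfun_apply (grad (x t)) w - blinfun_apply (grad (x s)) w) / (t - s) \<le> c + e"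
      if t: "s < t" "t < s + \<delta>" for t
    proof -
      have "blinfun_apply (grad (x t) - grad (x s)) w = D y (x t) - D y (x s) - D (x s) (x t)"
        by (simp add: w_def bregman_def blinfun.diff_left blinfun.diff_right)
      then have "blinfun_apply (grad (x t)) w - blinfun_apply (grad (x s)) w \<le> (t - s) * (c + e)"
        using D_nonneg[of "x s" "x t"] \<delta>(2)[OF t] by (simp add: blinfun.diff_left)
      then show ?thesis using t by (simp add: divide_le_eq mult.commute)
    qed
    then have "eventually (\<lambda>t. (blinfun_apply (grad (x t)) w - blinfun_apply (grad (x s)) w) / (t - s) \<le> c + e) (at_right s)"
      unfolding eventually_at_right_field using \<delta>(1) by (intro exI[of _ "s + \<delta>"]) auto
    then show ?thesis by (rule tendsto_upperbound[OF lim]) simp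
  qed
  then have "blinfun_apply v w \<le> c" by (rule field_le_epsilon)
  then show "lam * D y (x s) \<le> f y - f (x s) - blinfun_apply (- v) (y - x s)"
    by (simp add: c_def w_def blinfun.diff_right blinfun.minus_left)
qed

end

text \<open>A single bound is wanted on the half-line, whereas each \<open>G S\<close> is known on a
  bounded horizon. Two of them agree almost everywhere on the common part, both being the derivative
  of \<open>U\<close> there.\<close>

lemma locally_absolutely_continuous_if_densities:
  fixes U :: "real \<Rightarrow> 'b::real_normed_vector" and G :: "nat \<Rightarrow> real \<Rightarrow> 'b"
  assumes meas: "\<And>S. G S \<in> borel_measurable borel"
    and int: "\<And>S. set_integrable lborel {0..real S} (\<lambda>r. norm (G S r))"
    and le: "\<And>S s t. 0 \<le> s \<Longrightarrow> s \<le> t \<Longrightarrow> t \<le> real S \<Longrightarrow> norm (U t - U s) \<le> (LBINT r:{s..t}. norm (G S r))"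
    and der: "\<And>S. AE t in lborel. 0 < t \<and> t < real S \<longrightarrow> (U has_vector_derivative G S t) (at t)"
  shows "locally_absolutely_continuous U"
proof -
  \<comment> \<open>The horizon is the first integer strictly above \<open>r\<close>, because the
    derivative is known only in the open interval.\<close>
  define A where "A r = norm (G (Suc (nat \<lfloor>r\<rfloor>)) r)" for r
  have nG[measurable]: "(\<lambda>r. norm (G S r)) \<in> borel_measurable borel" for S
    using meas[of S] by (rule measurable_compose) (intro borel_measurable_continuous_onI continuous_intros)
  have A[measurable]: "A \<in> borel_measurable borel"
    unfolding A_def by (rule measurable_compose_countable[where f="\<lambda>S r. norm (G S r)"]) measurable
  have eq: "AE r in lborel. r \<in> {0..real S} \<longrightarrow> A r = norm (G S r)" for S
  proof -
    have "AE r in lborel. \<forall>S. 0 < r \<and> r < real S \<longrightarrow> (U has_vector_derivative G S r) (at r)"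
      unfolding AE_all_countable using der by blast
    moreover have "AE r in lborel. r \<noteq> 0 \<and> r \<noteq> real S"
      using AE_lborel_singleton[of 0] AE_lborel_singleton[of "real S"] by eventually_elim auto
    ultimately show ?thesis
    proof eventually_elim
      case (elim r)
      show ?case
      proof
        assume "r \<in> {0..real S}"
        then have r: "0 < r" "r < real S" using elim(2) by auto
        have "r < real (Suc (nat \<lfloor>r\<rfloor>))" using r by linarith
        then have "G (Suc (nat \<lfloor>r\<rfloor>)) r = G S r"
          using elim(1) r by (blast intro: vector_derivative_unique_at)
        then show "A r = norm (G S r)" by (simp add: A_def)
      qed
    qed
  qed
  show ?thesis
    unfolding locally_absolutely_continuous_def
  proof (intro exI[of _ A] conjI allI impI)
    fix T :: real assume "0 \<le> T"
    obtain S :: nat where S: "T \<le> S" using real_arch_simple by blast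
    have "set_integrable lborel {0..T} (\<lambda>r. norm (G S r))"
      using int[of S] by (rule set_integrable_subset) (use S in auto)
    then show "set_integrable lborel {0..T} A"
      unfolding set_integrable_def
    proof (rule integrable_cong_AE_imp)
      show "AE r in lborel. indicat_real {0..T} r *\<^sub>R norm (G S r) = indicat_real {0..T} r *\<^sub>R A r"
        using eq[of S] by eventually_elim (use S in \<open>auto split: split_indicator\<close>)
    qed measurable
  next
    fix s t :: real assume st: "0 \<le> s \<and> s \<le> t"
    obtain S :: nat where S: "t \<le> S" using real_arch_simple by blast
    have "norm (U t - U s) \<le> (LBINT r:{s..t}. norm (G S r))" using le st S by blast
    also have "\<dots> = (LBINT r:{s..t}. A r)"
      unfolding set_lebesgue_integral_def
    proof (rule integral_cong_AE)
      show "AE r in lborel. indicat_real {s..t} r *\<^sub>R norm (G S r) = indicat_real {s..t} r *\<^sub>R A r"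
        using eq[of S] by eventually_elim (use S st in \<open>auto split: split_indicator\<close>)
    qed measurable
    finally show "norm (U t - U s) \<le> (LBINT r:{s..t}. A r)" .
  qed
qed

lemma (in mirror_setting) mirror_flow_exists:
  assumes rnp: "radon_nikodym_property TYPE('a \<Rightarrow>\<^sub>L real)" and x0: "fin x\<^sub>0"
  shows "\<exists>x. mirror_flow \<Psi> \<Phi> x\<^sub>0 x"
proof -
  obtain p :: "nat \<Rightarrow> nat" and X :: "nat \<Rightarrow> nat \<Rightarrow> 'a" and x :: "real \<Rightarrow> 'a"
    where p: "\<And>n. 0 < p n" "filterlim p at_top sequentially"
    and X: "\<And>n. discrete_flow x\<^sub>0 (1 / p n) (X n)"
    and lim: "\<And>t::real. 0 \<le> t \<Longrightarrow> (\<lambda>n. X n (nat \<lfloor>t * p n\<rfloor>)) \<longlonglongrightarrow> x t"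
    and energy: "\<And>T::real. 0 \<le> T \<Longrightarrow> \<exists>C\<ge>0. \<forall>n m. real m \<le> T * p n \<longrightarrow>
      (\<Sum>k<m. real (p n) * (norm (grad (X n (Suc k)) - grad (X n k)))\<^sup>2) \<le> C\<^sup>2"
    by (rule discrete_flows_limit[OF x0]) (rule that, assumption+)
  have fin: "fin (x t)" if t: "0 \<le> t" for t
  proof -
    \<comment> \<open>The energy bound is uniform in \<open>n\<close> and \<open>k\<close>, so lower
      semicontinuity keeps the limit curve in the domain of \<Phi> at every time.\<close>
    have "\<Phi> (X n k) \<le> ereal (f x\<^sub>0)" for n k
    proof -
      have "fin (X n k)" using X[of n] unfolding discrete_flow_def by blast
      moreover have "f (X n k) \<le> f x\<^sub>0" using discrete_flow_energy[OF X] p(1)[of n] by simp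
      ultimately show ?thesis by (simp add: Phi_eq)
    qed
    then have "\<Phi> (x t) \<le> ereal (f x\<^sub>0)" using Phi_limit_le[OF lim[OF t]] by simp
    then show ?thesis by (rule le_less_trans) simp
  qed
  \<comment> \<open>The Radon-Nikodym property concerns finite measures, so a density is first
    chosen separately for each bounded horizon \<open>S\<close>.\<close>
  define density_on where "density_on S g \<longleftrightarrow> g \<in> borel_measurable borel \<and>
    set_integrable lborel {0..real S} (\<lambda>r. norm (g r)) \<and>
    (\<forall>s t::real. 0 \<le> s \<longrightarrow> s \<le> t \<longrightarrow> t \<le> S \<longrightarrow> norm (grad (x t) - grad (x s)) \<le> (LBINT r:{s..t}. norm (g r))) \<and>
    (AE t in lborel. 0 < t \<and> t < S \<longrightarrow> ((\<lambda>t. grad (x t)) has_vector_derivative g t) (at t))"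
    for S and g :: "real \<Rightarrow> 'a \<Rightarrow>\<^sub>L real"
  have "\<exists>g. density_on S g" for S
  proof -
    obtain C where C: "0 \<le> C" "\<forall>n m. real m \<le> real S * p n \<longrightarrow>
      (\<Sum>k<m. real (p n) * (norm (grad (X n (Suc k)) - grad (X n k)))\<^sup>2) \<le> C\<^sup>2"
      using energy[of "real S"] by auto
    have en: "(\<Sum>k<S * p n. real (p n) * (norm (grad (X n (Suc k)) - grad (X n k)))\<^sup>2) \<le> C\<^sup>2" for n
      using C(2) by simp
    have U: "(\<lambda>n. grad (X n (nat \<lfloor>t * p n\<rfloor>))) \<longlonglongrightarrow> grad (x t)" if "0 \<le> t" "t \<le> real S" for t
      using lim[OF that(1)] by (rule tendsto_gradient)
    show ?thesis unfolding density_on_def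
      by (rule density_of_limit_curve[where u="\<lambda>n k. grad (X n k)", OF rnp p C(1) en U]) blast+
  qed
  then obtain G where "\<And>S. density_on S (G S)" by metis
  then have G: "\<And>S. G S \<in> borel_measurable borel"
    "\<And>S. set_integrable lborel {0..real S} (\<lambda>r. norm (G S r))"
    "\<And>S s t. 0 \<le> s \<Longrightarrow> s \<le> t \<Longrightarrow> t \<le> real S \<Longrightarrow> norm (grad (x t) - grad (x s)) \<le> (LBINT r:{s..t}. norm (G S r))"
    "\<And>S. AE t in lborel. 0 < t \<and> t < real S \<longrightarrow> ((\<lambda>t. grad (x t)) has_vector_derivative G S t) (at t)"
    unfolding density_on_def by blast+
  have "x 0 = x\<^sub>0"
    using LIMSEQ_unique[OF lim[of 0], of x\<^sub>0] X by (simp add: discrete_flow_def)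
  moreover have "locally_absolutely_continuous (\<lambda>t. grad (x t))"
    by (rule locally_absolutely_continuous_if_densities[OF G])
  moreover have "AE t in lborel. 0 < t \<longrightarrow> (\<exists>\<xi>\<in>frechet_subdifferential \<Phi> (x t).
    ((\<lambda>s. grad (x s)) has_vector_derivative - \<xi>) (at t))"
  proof -
    have "AE t in lborel. \<forall>S::nat. 0 < t \<and> t < real S \<longrightarrow> ((\<lambda>t. grad (x t)) has_vector_derivative G S t) (at t)"
      unfolding AE_all_countable using G(4) by blast
    then show ?thesis
    proof (eventually_elim, intro impI)
      fix s :: real
      assume *: "\<forall>S::nat. 0 < s \<and> s < real S \<longrightarrow> ((\<lambda>t. grad (x t)) has_vector_derivative G S s) (at s)"
        and s: "0 < s"
      obtain S :: nat where "s < S" using reals_Archimedean2 by blast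
      with * s have der: "((\<lambda>t. grad (x t)) has_vector_derivative G S s) (at s)" by blast
      have "- G S s \<in> frechet_subdifferential \<Phi> (x s)"
      proof (rule subdifferential_if_variational_inequality[OF der fin])
        fix y :: 'a and e :: real assume ye: "fin y" "0 < e"
        have s0: "0 \<le> s" using s by simp
        show "\<exists>\<delta>>0. \<forall>t. s < t \<longrightarrow> t < s + \<delta> \<longrightarrow>
          D y (x t) - D y (x s) \<le> (t - s) * (f y - f (x s) - lam * D y (x s) + e)"
          by (rule limit_variational_inequality[OF p X lim energy s0 fin[OF s0] ye])
      qed (use s in simp)
      then show "\<exists>\<xi>\<in>frechet_subdifferential \<Phi> (x s). ((\<lambda>s. grad (x s)) has_vector_derivative - \<xi>) (at s)"
        using der by (intro bexI[of _ "- G S s"]) auto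
    qed
  qed
  ultimately show ?thesis unfolding mirror_flow_def by blast
qed

theorem theorem1p4:
  fixes \<Psi> :: "'a::banach \<Rightarrow> real"
    and \<Psi>s :: "('a \<Rightarrow>\<^sub>L real) \<Rightarrow> real"
    and \<Phi> :: "'a \<Rightarrow> ereal"
    and lam \<alpha> C\<^sub>\<alpha> \<beta> C\<^sub>\<beta> m\<^sub>\<beta> :: real
    and g :: "real \<Rightarrow> real"
    and x\<^sub>0 :: 'a
  assumes rnp: "radon_nikodym_property TYPE('a \<Rightarrow>\<^sub>L real)"
    and Psi_nonneg: "\<forall>x. 0 \<le> \<Psi> x"
    and Psi_convex: "convex_on UNIV \<Psi>"
    and Psi_C1: "C1_functional \<Psi>"
    and Psis_conjugate: "\<forall>\<phi>. convex_conjugate \<Psi> \<phi> = ereal (\<Psi>s \<phi>)"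
    and Psis_C1: "C1_functional \<Psi>s"
    and Phi_not_MInf: "\<forall>x. \<Phi> x \<noteq> -\<infinity>"
    and Phi_proper: "\<exists>x. \<Phi> x \<noteq> \<infinity>"
    and Phi_lsc: "lower_semicontinuous \<Phi>"
    and Phi_lambda_convex: "lambda_convex_for lam \<Psi> \<Phi>"
    and alpha: "1 < \<alpha>" "0 < C\<^sub>\<alpha>"
    and Psi_unif_convex: "\<forall>x y. norm (y - x) powr \<alpha> \<le> C\<^sub>\<alpha> * bregman \<Psi> y x"
    and g_cont: "continuous_on {0<..} g"
    and g_pos: "\<forall>r>0. 0 < g r"
    and g_at_0: "filterlim g at_top (at_right 0)"
    and Psis_bound:
      "\<forall>\<phi> \<psi>. g (norm \<phi> + norm \<psi>) * (norm (\<phi> - \<psi>))\<^sup>2 \<le> bregman \<Psi>s \<phi> \<psi>"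
    and beta: "0 < \<beta>" "0 < C\<^sub>\<beta>" "0 \<le> m\<^sub>\<beta>"
    and grad_growth: "\<forall>x. norm (gradient \<Psi> x) \<le> C\<^sub>\<beta> * norm x powr \<beta> + m\<^sub>\<beta>"
    and Phi_bounded_below: "(INF x. \<Phi> x) > -\<infinity>"
    and Phi_compact: "\<forall>r>0. \<forall>c::real. compact {x. norm x \<le> r \<and> \<Phi> x \<le> ereal c}"
    and x0_finite: "\<Phi> x\<^sub>0 < \<infinity>"
  shows "\<exists>x :: real \<Rightarrow> 'a. mirror_flow \<Psi> \<Phi> x\<^sub>0 x"
proof -
  interpret mirror_setting \<Psi> \<Psi>s \<Phi> lam \<alpha> C\<^sub>\<alpha> \<beta> C\<^sub>\<beta> m\<^sub>\<beta> g
    by unfold_locales fact+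
  show ?thesis by (rule mirror_flow_exists[OF rnp x0_finite])
qed

end
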